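(* Let $1<p<\infty$. The smallest constant $C(p)$ for which the inequality $$\|Mf\|_{L^p(\mathbb{R})}\le C(p)\,\|f\|_{L^p(\mathbb{R})}$$ holds for all $f\in\mathcal{P}\cap L^p(\mathbb{R})$ is $$c_p=\sup_{\tau>1}\frac{(\tau+1)^{\frac{p-1}{p}}+(\tau-1)^{\frac{p-1}{p}}}{2\tau\,\frac{p-1}{p}},$$ and this $c_p$ is the unique number satisfying $M(|\cdot|^{-1/p})(x)=c_p\,|x|^{-1/p}$ for all real $x\neq 0$.
   Context: For a locally integrable function $f$ on $\mathbb{R}$, the centered Hardy--Littlewood maximal function is $(Mf)(x)=\sup_{\delta>0}\frac{1}{2\delta}\int_{x-\delta}^{x+\delta}|f(t)|\,dt$. The class $\mathcal{P}$ of "peak-shaped" functions is the set of all positive (i.e. $f\ge 0$) functions $f$ on $\mathbb{R}$ which are convex except at one point: there is $c\in\mathbb{R}$ such that $f$ is convex on $(-\infty,c)$ and convex on $(c,\infty)$; $f$ is allowed to be discontinuous at $c$. *)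

theory Defs
  imports "HOL-Analysis.Analysis"
begin

(* With values in [0, \<infinity>]: the supremum may be infinite, e.g. at the exceptional point of a
   peak-shaped function. *)
definition maximal_function :: "(real \<Rightarrow> real) \<Rightarrow> real \<Rightarrow> ennreal" where
  "maximal_function f x =
     (SUP \<delta>\<in>{0<..}. (\<integral>\<^sup>+t\<in>{x - \<delta>..x + \<delta>}. ennreal \<bar>f t\<bar> \<partial>lebesgue) / ennreal (2 * \<delta>))"

(* x ^ a for x in [0, \<infinity>]; used for a > 0 only, where \<infinity> ^ a = \<infinity> and 0 ^ a = 0. *)
definition ennpow :: "ennreal \<Rightarrow> real \<Rightarrow> ennreal" where
  "ennpow x a = (if x = \<infinity> then \<infinity> else ennreal (enn2real x powr a))"

definition Lp_norm :: "real \<Rightarrow> (real \<Rightarrow> ennreal) \<Rightarrow> ennreal" where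
  "Lp_norm p g = ennpow (\<integral>\<^sup>+x. ennpow (g x) p \<partial>lebesgue) (1 / p)"

definition Lp_space :: "real \<Rightarrow> (real \<Rightarrow> real) set" where
  "Lp_space p =
     {f. f \<in> borel_measurable lebesgue \<and> Lp_norm p (\<lambda>x. ennreal \<bar>f x\<bar>) < \<infinity>}"

definition peak_shaped :: "(real \<Rightarrow> real) set" where
  "peak_shaped = {f. (\<forall>x. 0 \<le> f x) \<and> (\<exists>c. convex_on {..<c} f \<and> convex_on {c<..} f)}"

definition peak_quotient :: "real \<Rightarrow> real \<Rightarrow> real" where
  "peak_quotient p \<tau> =
     ((\<tau> + 1) powr ((p - 1) / p) + (\<tau> - 1) powr ((p - 1) / p)) / (2 * \<tau> * ((p - 1) / p))"

definition peak_const :: "real \<Rightarrow> real" where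
  "peak_const p = (SUP \<tau>\<in>{1<..}. peak_quotient p \<tau>)"

(* The supremum above is taken in the reals, so it is meaningful only because of this bound. *)
lemma bdd_above_peak_quotient:
  assumes "1 < p"
  shows "bdd_above (peak_quotient p ` {1<..})"
proof (rule bdd_aboveI2)
  fix \<tau> :: real
  assume "\<tau> \<in> {1<..}"
  then have t: "1 < \<tau>" by simp
  define q where "q = (p - 1) / p"
  have q: "0 < q" "q \<le> 1" using assms by (auto simp: q_def field_simps)
  have a: "(\<tau> + 1) powr q \<le> \<tau> + 1"
    using powr_mono[of q 1 "\<tau> + 1"] q t by simp
  have "(\<tau> - 1) powr q \<le> (\<tau> + 1) powr q"
    using q t by (intro powr_mono2) auto
  with a have "(\<tau> + 1) powr q + (\<tau> - 1) powr q \<le> 4 * \<tau>" using t by linarith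
  then have "peak_quotient p \<tau> \<le> 4 * \<tau> / (2 * \<tau> * q)"
    using q t unfolding peak_quotient_def q_def[symmetric] by (intro divide_right_mono) auto
  also have "\<dots> = 2 / q" using t q by (simp add: field_simps)
  finally show "peak_quotient p \<tau> \<le> 2 / ((p - 1) / p)" by (simp add: q_def)
qed

end

theory Submission
  imports Defs
begin

text \<open>
Translate the peak to 0 and let x > 0. A window centred at x that reaches across the peak is
[-v, v + 2x] with v \<ge> 0, and windows that stay on one side of the peak never win, because the
average of a convex function over a centred window increases with the window. So M f (x) is the
supremum over v of the mean of f over [-v, v + 2x] (maximal_function_eq_SUP_window_mean).

If v were a fixed multiple of x, Minkowski's inequality would give the constant peak_quotient p \<tau> with
v = (\<tau> - 1) x. The difficulty is that the best v depends on x. Two facts overcome it.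

First, convexity forces the best v to be nondecreasing in x (ex_best_above): once enlarging the window
pays at x, it pays at every larger centre (excess_persists). Hence, as x grows, both ends
u = v + 2x and v of the best window sweep out the two half lines, each at most once.

Second, the quantity 2 (v + x) g^p, where g is the best mean at x, is an exact potential for
the problem: between two successive windows it satisfies, without any error term,

  change of 2 (v + x) g^p + K g^p dx
    \<le> k1^(1 - p) (integral of f^p over the new part on the right of the peak)
     + k2^(1 - p) (integral of f^p over the new part on the left of the peak)

(energy_step). Only the tangent inequality p m^(p-1) y \<le> y^p + (p-1) m^p is used, and
k1 = 1 - \<tau>/p, k2 = 1 + \<tau>/p, K = (p - 1) (k2 - k1) are chosen so that it is an equality for the
power function |t|^(-1/p) with its optimal ratio \<tau>. Summing over a grid and refining bounds the integral
of (M f)^p over x > 0. For x < 0 the two weights exchange their roles, so the sum of both sides has the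
constant (k1^(1-p) + k2^(1-p)) / K, which equals c^p, where c is the maximum of peak_quotient p
(critical_weights, peak_const_critical).

The power function |t|^(-1/p) turns every mean into a value of peak_quotient, which identifies its maximal
function. It just fails to be in L^p, and the functions (1 + |t|)^(-a) with a decreasing to 1/p
show that no smaller constant works: their norms blow up, while M f differs from a multiple of f
only by a term whose contribution stays bounded (sharpness_inequality).
\<close>

section \<open>Primitives of convex profiles\<close>

text \<open>One side of a peak-shaped function, seen as a function on (0, \<infinity>). It is nevertheless a
function on all reals, so that a peak-shaped function f and its reflection are themselves profiles.\<close>

definition convex_profile :: "(real \<Rightarrow> real) \<Rightarrow> bool" where
  "convex_profile \<phi> \<longleftrightarrow> (\<forall>t. 0 \<le> \<phi> t) \<and> convex_on {0<..} \<phi> \<and> (\<forall>y. \<phi> integrable_on {0..y})"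

definition primitive :: "(real \<Rightarrow> real) \<Rightarrow> real \<Rightarrow> real" where
  "primitive \<phi> y = integral {0..y} \<phi>"

lemma primitive_0 [simp]: "primitive \<phi> 0 = 0"
  by (simp add: primitive_def)

lemma primitive_diff:
  assumes "convex_profile \<phi>" "0 \<le> x" "x \<le> y"
  shows "(\<phi> has_integral (primitive \<phi> y - primitive \<phi> x)) {x..y}"
proof -
  have i: "\<phi> integrable_on {0..y}" using assms by (auto simp: convex_profile_def)
  have "integral {0..x} \<phi> + integral {x..y} \<phi> = integral {0..y} \<phi>"
    using assms by (intro Henstock_Kurzweil_Integration.integral_combine i) auto
  moreover have "\<phi> integrable_on {x..y}"
    using i by (rule integrable_on_subinterval) (use assms in auto)
  ultimately show ?thesis unfolding primitive_def by (metis add_diff_cancel_left' integrable_integral)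
qed

lemma primitive_mono:
  assumes "convex_profile \<phi>" "0 \<le> x" "x \<le> y"
  shows "primitive \<phi> x \<le> primitive \<phi> y"
  using has_integral_nonneg[OF primitive_diff[OF assms]] assms by (auto simp: convex_profile_def)

lemma primitive_nonneg: "convex_profile \<phi> \<Longrightarrow> 0 \<le> y \<Longrightarrow> 0 \<le> primitive \<phi> y"
  using primitive_mono[of \<phi> 0 y] by simp

lemma continuous_on_primitive:
  assumes "convex_profile \<phi>"
  shows "continuous_on {0..y} (primitive \<phi>)"
  using indefinite_integral_continuous_1[of \<phi> 0 y] assms
  unfolding primitive_def[abs_def] convex_profile_def by blast

lemma convex_above_chord_extension:
  fixes f :: "real \<Rightarrow> real"
  assumes "convex_on S f" "a \<in> S" "b \<in> S" "t \<in> S" "a < b" "t \<notin> {a<..<b}"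
  shows "f a + (f b - f a) / (b - a) * (t - a) \<le> f t"
proof -
  define k where "k = (f b - f a) / (b - a)"
  have k: "f b = f a + k * (b - a)" using assms by (simp add: k_def)
  consider "t = a" | "t = b" | "t < a" | "b < t" using assms(6) by fastforce
  then show ?thesis
  proof cases
    case 3
    have "convex_on {t..b} f"
      using assms by (meson convex_on_imp_convex convex_on_subset convex_real_interval(5) is_interval_1 is_interval_convex_1 atLeastAtMost_iff subsetI)
    then have "f a \<le> (f b - f t) / (b - t) * (a - t) + f t"
      using assms 3 by (intro convex_onD_Icc') auto
    then have "f a * (b - t) \<le> (f b - f t) * (a - t) + f t * (b - t)"
      using 3 assms by (simp add: divide_simps split: if_splits)
    then have "0 \<le> (b - a) * (f t - f a - k * (t - a))"
      unfolding k by (simp add: algebra_simps)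
    then show ?thesis using assms unfolding k_def by (simp add: zero_le_mult_iff)
  next
    case 4
    have "convex_on {a..t} f"
      using assms by (meson convex_on_imp_convex convex_on_subset convex_real_interval(5) is_interval_1 is_interval_convex_1 atLeastAtMost_iff subsetI)
    then have "f b \<le> (f t - f a) / (t - a) * (b - a) + f a"
      using assms 4 by (intro convex_onD_Icc') auto
    then have "f b * (t - a) \<le> (f t - f a) * (b - a) + f a * (t - a)"
      using 4 assms by (simp add: divide_simps split: if_splits)
    then have "0 \<le> (b - a) * (f t - f a - k * (t - a))"
      unfolding k by (simp add: algebra_simps)
    then show ?thesis using assms unfolding k_def by (simp add: zero_le_mult_iff)
  qed (use assms in \<open>auto simp: k_def[symmetric] k\<close>)
qed

lemma convex_below_chord:
  fixes f :: "real \<Rightarrow> real"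
  assumes "convex_on S f" "{a..b} \<subseteq> S" "a < b" "t \<in> {a..b}"
  shows "f t \<le> f a + (f b - f a) / (b - a) * (t - a)"
proof -
  have "convex_on {a..b} f" using assms by (meson convex_on_subset convex_real_interval)
  then show ?thesis using convex_onD_Icc'[of a b f t] assms by auto
qed

lemma has_integral_affine:
  fixes a b :: real assumes "a \<le> b"
  shows "((\<lambda>t. \<alpha> + \<beta> * (t - d)) has_integral (\<alpha> * (b - a) + \<beta> * ((b - d)^2 - (a - d)^2) / 2)) {a..b}"
proof -
  have "((\<lambda>t. \<alpha> + \<beta> * (t - d)) has_integral ((\<alpha> * b + \<beta> * (b - d)^2 / 2) - (\<alpha> * a + \<beta> * (a - d)^2 / 2))) {a..b}"
    using assms
    by (intro fundamental_theorem_of_calculus)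
       (auto simp: has_real_derivative_iff_has_vector_derivative[symmetric] intro!: derivative_eq_intros)
  moreover have "(\<alpha> * b + \<beta> * (b - d)^2 / 2) - (\<alpha> * a + \<beta> * (a - d)^2 / 2)
      = \<alpha> * (b - a) + \<beta> * ((b - d)^2 - (a - d)^2) / 2" by (simp add: algebra_simps diff_divide_distrib)
  ultimately show ?thesis by simp
qed

lemma has_integral_le_Ioo:
  fixes f g :: "real \<Rightarrow> real"
  assumes "(f has_integral i) {a..b}" "(g has_integral j) {a..b}"
    and "\<And>x. x \<in> {a<..<b} \<Longrightarrow> f x \<le> g x"
  shows "i \<le> j"
  using assms has_integral_le[of f i "{a<..<b}" g j] by (simp add: has_integral_Icc_iff_Ioo)

lemma primitive_diff_trapezoid:
  assumes \<phi>: "convex_profile \<phi>" and xy: "0 < x" "x \<le> y"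
  shows "primitive \<phi> y - primitive \<phi> x \<le> (y - x) * (\<phi> x + \<phi> y) / 2"
proof (cases "x = y")
  case False
  then have xy': "x < y" using xy by simp
  have "primitive \<phi> y - primitive \<phi> x \<le> \<phi> x * (y - x) + (\<phi> y - \<phi> x) / (y - x) * ((y - x)^2 - (x - x)^2) / 2"
    using \<phi> xy xy'
    by (intro has_integral_le[OF primitive_diff[OF \<phi>] has_integral_affine] convex_below_chord[of "{0<..}"])
       (auto simp: convex_profile_def)
  also have "\<dots> = (y - x) * (\<phi> x + \<phi> y) / 2"
    using xy' by (simp add: power2_eq_square) (simp add: field_simps)
  finally show ?thesis .
qed simp

text \<open>The chord from u to w, prolonged to the left of u, stays below the profile. The resulting quadratic
term is what makes the best window grow with its centre.\<close>

lemma primitive_ge_tangent: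
  assumes \<phi>: "convex_profile \<phi>" and uw: "0 < u" "u < w"
  shows "\<phi> u * u + (\<phi> u - \<phi> w) / (w - u) * u^2 / 2 \<le> primitive \<phi> u"
proof -
  define k where "k = (\<phi> w - \<phi> u) / (w - u)"
  have "\<phi> u * (u - 0) + k * ((u - u)^2 - (0 - u)^2) / 2 \<le> primitive \<phi> u - primitive \<phi> 0"
  proof (rule has_integral_le_Ioo[OF has_integral_affine primitive_diff[OF \<phi>]])
    fix x assume "x \<in> {0<..<u}"
    then show "\<phi> u + k * (x - u) \<le> \<phi> x"
      unfolding k_def using \<phi> uw 
      by (intro convex_above_chord_extension[of "{0<..}"]) (auto simp: convex_profile_def)
  qed (use uw in auto)
  moreover have "(\<phi> u - \<phi> w) / (w - u) = - k" by (metis k_def minus_diff_eq minus_divide_left)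
  ultimately show ?thesis by simp
qed

section \<open>Optimal windows grow with their centre\<close>

lemma primitive_diff_ge:
  assumes \<phi>: "convex_profile \<phi>" "antimono_on {0<..} \<phi>" and "0 \<le> x" "x \<le> y" "0 < y"
  shows "\<phi> y * (y - x) \<le> primitive \<phi> y - primitive \<phi> x"
proof (rule has_integral_le_Ioo[OF _ primitive_diff])
  show "((\<lambda>_. \<phi> y) has_integral \<phi> y * (y - x)) {x..y}"
    using has_integral_const_real[of "\<phi> y" x y] assms by (simp add: mult.commute)
  fix t assume "t \<in> {x<..<y}"
  then show "\<phi> y \<le> \<phi> t" using assms by (intro monotone_onD[OF \<phi>(2)]) auto
qed (use assms in auto)

lemma primitive_diff_le:
  assumes \<phi>: "convex_profile \<phi>" "antimono_on {0<..} \<phi>" and "0 < x" "x \<le> y"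
  shows "primitive \<phi> y - primitive \<phi> x \<le> \<phi> x * (y - x)"
proof (rule has_integral_le_Ioo[OF primitive_diff])
  show "((\<lambda>_. \<phi> x) has_integral \<phi> x * (y - x)) {x..y}"
    using has_integral_const_real[of "\<phi> x" x y] assms by (simp add: mult.commute)
  fix t assume "t \<in> {x<..<y}"
  then show "\<phi> t \<le> \<phi> x" using assms by (intro monotone_onD[OF \<phi>(2)]) auto
qed (use assms in auto)

text \<open>For a decreasing profile the average over [0, y] decreases in y; this is the source of the
monotonicity of the maximal function on each side of the peak.\<close>

lemma primitive_star_shaped:
  assumes \<phi>: "convex_profile \<phi>" "antimono_on {0<..} \<phi>" and "0 \<le> y" "0 < l" "l \<le> 1"
  shows "l * primitive \<phi> y \<le> primitive \<phi> (l * y)"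
proof (cases "y = 0")
  case False
  then have y: "0 < y" using assms by simp
  have "primitive \<phi> y - primitive \<phi> (l * y) \<le> \<phi> (l * y) * (y - l * y)"
    using assms y by (intro primitive_diff_le[OF \<phi>]) auto
  then have "l * (primitive \<phi> y - primitive \<phi> (l * y)) \<le> (1 - l) * (\<phi> (l * y) * (l * y))"
    using mult_left_mono[of _ _ l] assms by (fastforce simp: algebra_simps)
  moreover have "\<phi> (l * y) * (l * y) \<le> primitive \<phi> (l * y)"
    using primitive_diff_ge[OF \<phi>, of 0 "l * y"] assms y by simp
  then have "(1 - l) * (\<phi> (l * y) * (l * y)) \<le> (1 - l) * primitive \<phi> (l * y)"
    using assms by (intro mult_left_mono) auto
  ultimately show ?thesis by (simp add: algebra_simps)
qed simp

text \<open>The average over the window [-v, v + 2x] around x of the function with right half \<phi> and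
reflected left half \<psi>.\<close>

definition window_mean :: "(real \<Rightarrow> real) \<Rightarrow> (real \<Rightarrow> real) \<Rightarrow> real \<Rightarrow> real \<Rightarrow> real" where
  "window_mean \<phi> \<psi> x v = (primitive \<phi> (v + 2 * x) + primitive \<psi> v) / (2 * (v + x))"

lemma window_mean_nonneg:
  assumes "convex_profile \<phi>" "convex_profile \<psi>" "0 < x" "0 \<le> v"
  shows "0 \<le> window_mean \<phi> \<psi> x v"
  using assms by (auto simp: window_mean_def intro!: divide_nonneg_nonneg add_nonneg_nonneg primitive_nonneg)

lemma window_mean_scale:
  assumes "convex_profile \<phi>" "convex_profile \<psi>" "antimono_on {0<..} \<phi>" "antimono_on {0<..} \<psi>"
    and x: "0 < x" "0 \<le> v" and l: "0 < l" "l \<le> 1"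
  shows "window_mean \<phi> \<psi> x v \<le> window_mean \<phi> \<psi> (l * x) (l * v)"
proof -
  have "l * (primitive \<phi> (v + 2 * x) + primitive \<psi> v) \<le> primitive \<phi> (l * (v + 2 * x)) + primitive \<psi> (l * v)"
    using primitive_star_shaped[of \<phi> "v + 2 * x" l] primitive_star_shaped[of \<psi> v l] assms
    by (simp add: distrib_left)
  moreover have "window_mean \<phi> \<psi> x v = l * (primitive \<phi> (v + 2 * x) + primitive \<psi> v) / (l * (2 * (v + x)))"
    using l by (simp add: window_mean_def)
  moreover have "window_mean \<phi> \<psi> (l * x) (l * v)
      = (primitive \<phi> (l * (v + 2 * x)) + primitive \<psi> (l * v)) / (l * (2 * (v + x)))"
    by (simp add: window_mean_def algebra_simps)
  moreover have "0 \<le> l * (2 * (v + x))" using x l by simp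
  ultimately show ?thesis by (metis divide_right_mono)
qed

lemma continuous_on_window_mean:
  assumes "convex_profile \<phi>" "convex_profile \<psi>" "0 < x"
  shows "continuous_on {0..V} (window_mean \<phi> \<psi> x)"
proof -
  have "continuous_on {0..V} (\<lambda>v. primitive \<phi> (v + 2 * x))"
    by (rule continuous_on_compose2[OF continuous_on_primitive[OF assms(1), of "V + 2 * x"]])
       (use assms in \<open>auto intro!: continuous_intros\<close>)
  then show ?thesis unfolding window_mean_def[abs_def]
    using assms by (auto intro!: continuous_intros continuous_on_primitive)
qed

text \<open>Up to the positive factor 2 (v + x), this is the derivative of the window mean with respect to v: both new
end values count against twice the current mean.\<close>

definition excess :: "(real \<Rightarrow> real) \<Rightarrow> (real \<Rightarrow> real) \<Rightarrow> real \<Rightarrow> real \<Rightarrow> real" where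
  "excess \<phi> \<psi> x v = \<phi> (v + 2 * x) + \<psi> v - 2 * window_mean \<phi> \<psi> x v"

text \<open>Write u = v + 2x, b = \<psi> v and let -k be the slope of the chord of \<phi> from u to u + 2d. Bounding the integral of \<phi> over
[0, u] from below by that of the prolonged chord, and that of \<psi> over [0, v] by b v, a nonnegative excess
gives k u^2 \<le> (b - \<phi> u) (u - v), hence k (u + v) \<le> b - \<phi> u. By the trapezoidal bound this is exactly what is needed
for the excess to remain nonnegative when the centre moves to the right by d.\<close>

lemma excess_persists:
  assumes p: "convex_profile \<phi>" "convex_profile \<psi>" "antimono_on {0<..} \<phi>" "antimono_on {0<..} \<psi>"
    and x: "0 < x" "x \<le> x'" "0 < v" and E: "0 \<le> excess \<phi> \<psi> x v"
  shows "0 \<le> excess \<phi> \<psi> x' v"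
proof (cases "x = x'")
  case False
  define u where "u = v + 2 * x"
  define w where "w = v + 2 * x'"
  define d where "d = x' - x"
  define b where "b = \<psi> v"
  define k where "k = (\<phi> u - \<phi> w) / (w - u)"
  have d: "0 < d" using x False by (simp add: d_def)
  have uw: "0 < u" "u < w" "w - u = 2 * d" using x d by (auto simp: u_def w_def d_def)
  have "\<phi> w \<le> \<phi> u" using uw by (intro monotone_onD[OF p(3)]) auto
  then have k0: "0 \<le> k" using uw by (simp add: k_def)
  have kw: "\<phi> w = \<phi> u - 2 * d * k" using uw by (simp add: k_def)
  have T: "\<phi> u * u + k * u^2 / 2 \<le> primitive \<phi> u"
    using primitive_ge_tangent[OF p(1) uw(1,2)] by (simp add: k_def)
  have G: "b * v \<le> primitive \<psi> v" using primitive_diff_ge[OF p(2,4), of 0 v] x by (simp add: b_def)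
  have E1: "primitive \<phi> u + primitive \<psi> v \<le> (\<phi> u + b) * (v + x)"
    using E x by (simp add: excess_def window_mean_def u_def b_def field_simps)
  have "k * u^2 \<le> (b - \<phi> u) * (u - v)"
    using E1 T G by (simp add: u_def power2_eq_square field_simps)
  moreover have "k * ((u + v) * (u - v)) \<le> k * u^2"
    using k0 x by (intro mult_left_mono) (auto simp: power2_eq_square algebra_simps)
  ultimately have "(k * (u + v)) * (u - v) \<le> (b - \<phi> u) * (u - v)" by (simp add: mult.assoc)
  then have key: "k * (u + v) \<le> b - \<phi> u" using x by (simp add: u_def)
  have Z: "primitive \<phi> w - primitive \<phi> u \<le> d * (\<phi> u + \<phi> w)"
    using primitive_diff_trapezoid[OF p(1), of u w] uw by simp
  have "0 \<le> d * (b - \<phi> u - k * (u + v))" using key d by simp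
  also have "\<dots> = (\<phi> w + b) * (v + x') - (\<phi> u + b) * (v + x) - d * (\<phi> u + \<phi> w)"
    unfolding kw by (simp add: d_def u_def algebra_simps)
  also have "\<dots> \<le> (\<phi> w + b) * (v + x') - (primitive \<phi> w + primitive \<psi> v)" using E1 Z by simp
  finally show ?thesis
    using x by (simp add: excess_def window_mean_def w_def b_def field_simps)
qed (use E in simp)

text \<open>Only smaller windows are compared, so that the conclusion also holds when the optimum sits at the upper
end of the admissible range of v.\<close>

lemma excess_nonneg_at_max:
  assumes p: "convex_profile \<phi>" "convex_profile \<psi>" "antimono_on {0<..} \<phi>" "antimono_on {0<..} \<psi>"
    and x: "0 < x" "0 < v" and max: "\<And>t. 0 \<le> t \<Longrightarrow> t \<le> v \<Longrightarrow> window_mean \<phi> \<psi> x t \<le> window_mean \<phi> \<psi> x v"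
  shows "0 \<le> excess \<phi> \<psi> x v"
proof -
  define g where "g = window_mean \<phi> \<psi> x v"
  define u where "u = v + 2 * x"
  have c: "continuous_on {0<..} \<phi>" "continuous_on {0<..} \<psi>"
    using p by (auto simp: convex_profile_def intro!: convex_on_continuous)
  have "isCont \<phi> u" "isCont \<psi> v"
    using c x by (auto simp: u_def continuous_on_eq_continuous_at)
  then have "((\<lambda>h. \<phi> (u - h) + \<psi> (v - h)) \<longlongrightarrow> \<phi> (u - 0) + \<psi> (v - 0)) (at_right 0)"
    by (intro tendsto_add isCont_tendsto_compose[of _ \<phi>] isCont_tendsto_compose[of _ \<psi>] tendsto_diff tendsto_const tendsto_ident_at) auto
  moreover have "\<forall>\<^sub>F h in at_right 0. 2 * g \<le> \<phi> (u - h) + \<psi> (v - h)"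
    unfolding eventually_at_right_field
  proof (intro exI[of _ v] conjI allI impI)
    fix h assume h: "0 < h" "h < v"
    have a: "primitive \<phi> u + primitive \<psi> v = g * (2 * (v + x))" using x by (simp add: g_def window_mean_def u_def)
    have "primitive \<phi> (u - h) + primitive \<psi> (v - h) \<le> g * (2 * (v - h + x))"
    proof -
      have "window_mean \<phi> \<psi> x (v - h) \<le> g" using max[of "v - h"] h by (simp add: g_def)
      moreover have "0 < 2 * (v - h + x)" using h x by simp
      moreover have "u - h = v - h + 2 * x" by (simp add: u_def)
      ultimately show ?thesis unfolding window_mean_def[of \<phi> \<psi> x "v - h"] by (simp only: pos_divide_le_eq)
    qed
    with a have "g * (2 * h) \<le> (primitive \<phi> u - primitive \<phi> (u - h)) + (primitive \<psi> v - primitive \<psi> (v - h))"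
      by (simp add: algebra_simps)
    also have "\<dots> \<le> \<phi> (u - h) * (u - (u - h)) + \<psi> (v - h) * (v - (v - h))"
      using h x by (intro add_mono primitive_diff_le p) (auto simp: u_def)
    finally have "(2 * g) * h \<le> (\<phi> (u - h) + \<psi> (v - h)) * h" by (simp add: algebra_simps)
    then show "2 * g \<le> \<phi> (u - h) + \<psi> (v - h)" using h by simp
  qed (use x in auto)
  ultimately have "2 * g \<le> \<phi> (u - 0) + \<psi> (v - 0)" by (rule tendsto_lowerbound) simp
  then show ?thesis by (simp add: excess_def g_def u_def)
qed

lemma window_mean_le_if_excess_nonneg:
  assumes p: "convex_profile \<phi>" "convex_profile \<psi>" "antimono_on {0<..} \<phi>" "antimono_on {0<..} \<psi>"
    and x: "0 < x" "0 \<le> t" "t \<le> v" "0 < v" and E: "0 \<le> excess \<phi> \<psi> x v"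
  shows "window_mean \<phi> \<psi> x t \<le> window_mean \<phi> \<psi> x v"
proof -
  define g where "g = window_mean \<phi> \<psi> x v"
  define u where "u = v + 2 * x"
  define h where "h = v - t"
  have "\<phi> u * (u - (u - h)) + \<psi> v * (v - (v - h))
      \<le> (primitive \<phi> u - primitive \<phi> (u - h)) + (primitive \<psi> v - primitive \<psi> (v - h))"
    using x by (intro add_mono primitive_diff_ge p) (auto simp: u_def h_def)
  moreover have "(2 * g) * h \<le> (\<phi> u + \<psi> v) * h"
    using E x by (intro mult_right_mono) (auto simp: excess_def g_def u_def h_def)
  moreover have "primitive \<phi> u + primitive \<psi> v = g * (2 * (v + x))" using x by (simp add: g_def window_mean_def u_def)
  ultimately have "primitive \<phi> (u - h) + primitive \<psi> (v - h) \<le> g * (2 * (v - h + x))"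
    by (simp add: algebra_simps)
  moreover have "u - h = t + 2 * x" "v - h = t" by (simp_all add: u_def h_def)
  ultimately have "primitive \<phi> (t + 2 * x) + primitive \<psi> t \<le> g * (2 * (t + x))" by metis
  moreover have "0 < 2 * (t + x)" using x by simp
  ultimately show ?thesis unfolding g_def[symmetric] window_mean_def[of \<phi> \<psi> x t] by (simp only: pos_divide_le_eq)
qed

text \<open>The half-width parameter is restricted to [0, V], which guarantees that an optimal window exists; V
tends to infinity later.\<close>

definition is_best :: "(real \<Rightarrow> real) \<Rightarrow> (real \<Rightarrow> real) \<Rightarrow> real \<Rightarrow> real \<Rightarrow> real \<Rightarrow> bool" where
  "is_best \<phi> \<psi> V x v \<longleftrightarrow> v \<in> {0..V} \<and> (\<forall>t\<in>{0..V}. window_mean \<phi> \<psi> x t \<le> window_mean \<phi> \<psi> x v)"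

lemma ex_best:
  assumes "convex_profile \<phi>" "convex_profile \<psi>" "0 < x" "0 \<le> V"
  shows "\<exists>v. is_best \<phi> \<psi> V x v"
  using continuous_attains_sup[OF compact_Icc _ continuous_on_window_mean[OF assms(1,2,3)], of V] assms
  by (auto simp: is_best_def)

text \<open>If the best window at x' were smaller than the one at x, then the persistent excess would make the window
mean at x' increase up to v, so that v is itself optimal at x'.\<close>

lemma ex_best_above:
  assumes p: "convex_profile \<phi>" "convex_profile \<psi>" "antimono_on {0<..} \<phi>" "antimono_on {0<..} \<psi>"
    and x: "0 < x" "x \<le> x'" and v: "is_best \<phi> \<psi> V x v"
  shows "\<exists>v'\<ge>v. is_best \<phi> \<psi> V x' v'"
proof -
  have V: "0 \<le> v" "v \<le> V" using v by (auto simp: is_best_def)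
  obtain w where w: "is_best \<phi> \<psi> V x' w" using ex_best[OF p(1,2), of x' V] x V by auto
  show ?thesis
  proof (cases "v \<le> w")
    case False
    then have wv: "0 \<le> w" "w \<le> v" "0 < v" using w by (auto simp: is_best_def)
    have "0 \<le> excess \<phi> \<psi> x v"
      using v V by (intro excess_nonneg_at_max[OF p x(1) wv(3)]) (auto simp: is_best_def)
    then have "0 \<le> excess \<phi> \<psi> x' v" by (rule excess_persists[OF p x wv(3)])
    then have "window_mean \<phi> \<psi> x' w \<le> window_mean \<phi> \<psi> x' v"
      using x wv by (intro window_mean_le_if_excess_nonneg[OF p]) auto
    then have "is_best \<phi> \<psi> V x' v" using w V by (force simp: is_best_def)
    then show ?thesis by blast
  qed (use w in blast)
qed

lemma ex_monotone_best:
  assumes p: "convex_profile \<phi>" "convex_profile \<psi>" "antimono_on {0<..} \<phi>" "antimono_on {0<..} \<psi>"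
    and h: "0 < h" "0 \<le> V"
  shows "\<exists>v. \<forall>n::nat. is_best \<phi> \<psi> V (real (Suc n) * h) (v n) \<and> v n \<le> v (Suc n)"
proof (rule dependent_nat_choice)
  show "\<exists>v. is_best \<phi> \<psi> V (real (Suc 0) * h) v" using ex_best[OF p(1,2)] h by simp
  fix v n assume "is_best \<phi> \<psi> V (real (Suc n) * h) v"
  then show "\<exists>v'. is_best \<phi> \<psi> V (real (Suc (Suc n)) * h) v' \<and> v \<le> v'"
    using ex_best_above[OF p, of "real (Suc n) * h" "real (Suc (Suc n)) * h" V v] h by auto
qed

section \<open>The energy inequality\<close>

text \<open>The graph of t \<mapsto> t^p lies above its tangent at m.\<close>

lemma powr_tangent:
  fixes y m p :: real
  assumes "1 < p" "0 \<le> y" "0 \<le> m"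
  shows "p * m powr (p - 1) * y \<le> y powr p + (p - 1) * m powr p"
proof -
  have "y * m powr (p - 1) \<le> y powr p / p + (m powr (p - 1)) powr (p / (p - 1)) / (p / (p - 1))"
    using assms by (intro Youngs_inequality) (auto simp: field_simps)
  also have "(m powr (p - 1)) powr (p / (p - 1)) = m powr p" using assms by (simp add: powr_powr)
  finally show ?thesis using assms by (simp add: field_simps)
qed

text \<open>The tangent inequality at the point k g, integrated and divided by k^(p-1). The factor k is the ratio between the
expected value of \<phi> at the end of the window and the mean g.\<close>

lemma powr_integral_step:
  assumes \<phi>: "convex_profile \<phi>" and p: "1 < p" "0 < k" "0 \<le> g" and ab: "0 \<le> a" "a \<le> b"
    and i: "(\<lambda>t. \<phi> t powr p) integrable_on {0..b}"
  shows "p * g powr (p - 1) * (primitive \<phi> b - primitive \<phi> a)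
    \<le> k powr (1 - p) * (primitive (\<lambda>t. \<phi> t powr p) b - primitive (\<lambda>t. \<phi> t powr p) a)
      + (p - 1) * k * g powr p * (b - a)"
proof -
  let ?\<phi>p = "\<lambda>t. \<phi> t powr p"
  have "integral {0..a} ?\<phi>p + integral {a..b} ?\<phi>p = integral {0..b} ?\<phi>p"
    using ab i by (intro Henstock_Kurzweil_Integration.integral_combine) auto
  moreover have "?\<phi>p integrable_on {a..b}" using i by (rule integrable_on_subinterval) (use ab in auto)
  ultimately have I: "(?\<phi>p has_integral (primitive ?\<phi>p b - primitive ?\<phi>p a)) {a..b}"
    unfolding primitive_def by (metis add_diff_cancel_left' integrable_integral)
  have C: "((\<lambda>_. (p - 1) * k * g powr p) has_integral (p - 1) * k * g powr p * (b - a)) {a..b}"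
    using has_integral_const_real[of "(p - 1) * k * g powr p" a b] ab by (simp add: mult.commute)
  show ?thesis
  proof (rule has_integral_le[OF has_integral_mult_right[OF primitive_diff[OF \<phi> ab]]
        has_integral_add[OF has_integral_mult_right[OF I] C]])
    fix t assume "t \<in> {a..b}"
    have "p * (k * g) powr (p - 1) * \<phi> t \<le> \<phi> t powr p + (p - 1) * (k * g) powr p"
      using p \<phi> by (intro powr_tangent) (auto simp: convex_profile_def)
    then have "k powr (1 - p) * (p * (k * g) powr (p - 1) * \<phi> t)
        \<le> k powr (1 - p) * (\<phi> t powr p + (p - 1) * (k * g) powr p)"
      by (intro mult_left_mono) auto
    moreover have "k powr (1 - p) * (k * g) powr (p - 1) = g powr (p - 1)"
      using p by (simp add: powr_mult powr_add[symmetric] mult.assoc[symmetric])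
    moreover have "k powr (1 - p) * (k * g) powr p = k * g powr p"
      using p by (simp add: powr_mult powr_add[symmetric] mult.assoc[symmetric])
    ultimately show "p * g powr (p - 1) * \<phi> t \<le> k powr (1 - p) * \<phi> t powr p + (p - 1) * k * g powr p"
      by (metis (no_types, opaque_lifting) distrib_left mult.assoc mult.left_commute)
  qed
qed

text \<open>With S = 2 (v + x), the tangent inequality at k1 g' and k2 g' bounds the right-hand side from below by
p g'^(p-1) (S' g' - S g) - (p-1) g'^p (k1 (u' - u) + k2 (v' - v)). Since k1 + k2 = 2, the last bracket is
(S' - S) - (k2 - k1) (x' - x). The tangent inequality once more, comparing g with g', turns the result into the
difference of S g^p. Evaluating at the new mean g' rather than at g is what makes the step exact.

The degenerate window x = v = 0 is allowed for the first step of the chain.\<close>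

lemma energy_step:
  assumes pr: "convex_profile \<phi>" "convex_profile \<psi>" and p: "1 < p"
    and i: "\<And>y. (\<lambda>t. \<phi> t powr p) integrable_on {0..y}" "\<And>y. (\<lambda>t. \<psi> t powr p) integrable_on {0..y}"
    and k: "0 < k1" "0 < k2" "k1 + k2 = 2" "(p - 1) * (k2 - k1) = K"
    and x: "0 \<le> x" "x \<le> x'" "0 \<le> v" "v \<le> v'" and g0: "0 \<le> g" "0 \<le> g'"
    and g: "2 * (v + x) * g = primitive \<phi> (v + 2 * x) + primitive \<psi> v"
           "2 * (v' + x') * g' = primitive \<phi> (v' + 2 * x') + primitive \<psi> v'"
  shows "2 * (v' + x') * g' powr p - 2 * (v + x) * g powr p + K * (x' - x) * g' powr p
    \<le> k1 powr (1 - p) * (primitive (\<lambda>t. \<phi> t powr p) (v' + 2 * x') - primitive (\<lambda>t. \<phi> t powr p) (v + 2 * x))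
      + k2 powr (1 - p) * (primitive (\<lambda>t. \<psi> t powr p) v' - primitive (\<lambda>t. \<psi> t powr p) v)"
proof -
  define S where "S = 2 * (v + x)"
  define S' where "S' = 2 * (v' + x')"
  define W where "W = g' powr p"
  have gW: "g' powr (p - 1) * g' = W"
    using g0 p by (cases "g' = 0") (auto simp: W_def powr_mult_base mult.commute)
  have a: "p * g' powr (p - 1) * (primitive \<phi> (v' + 2 * x') - primitive \<phi> (v + 2 * x))
    \<le> k1 powr (1 - p) * (primitive (\<lambda>t. \<phi> t powr p) (v' + 2 * x') - primitive (\<lambda>t. \<phi> t powr p) (v + 2 * x))
      + (p - 1) * k1 * W * (v' + 2 * x' - (v + 2 * x))"
    unfolding W_def by (rule powr_integral_step[OF pr(1) p k(1) g0(2) _ _ i(1)]) (use x in auto)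
  have b: "p * g' powr (p - 1) * (primitive \<psi> v' - primitive \<psi> v)
    \<le> k2 powr (1 - p) * (primitive (\<lambda>t. \<psi> t powr p) v' - primitive (\<lambda>t. \<psi> t powr p) v)
      + (p - 1) * k2 * W * (v' - v)"
    unfolding W_def by (rule powr_integral_step[OF pr(2) p k(2) g0(2) _ _ i(2)]) (use x in auto)
  have k1: "k1 = 2 - k2" using k by simp
  have "(p - 1) * k1 * W * (v' + 2 * x' - (v + 2 * x)) + (p - 1) * k2 * W * (v' - v)
      = (p - 1) * W * (S' - S) - K * (x' - x) * W"
    unfolding k(4)[symmetric] k1 by (simp add: S_def S'_def algebra_simps)
  moreover have "p * g' powr (p - 1) * (primitive \<phi> (v' + 2 * x') - primitive \<phi> (v + 2 * x))
      + p * g' powr (p - 1) * (primitive \<psi> v' - primitive \<psi> v) = p * g' powr (p - 1) * (S' * g' - S * g)"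
    unfolding S_def S'_def g by (simp add: algebra_simps)
  moreover have "p * g' powr (p - 1) * (S' * g' - S * g) = p * S' * W - S * (p * g' powr (p - 1) * g)"
    unfolding gW[symmetric] by (simp add: algebra_simps)
  moreover have "S * (p * g' powr (p - 1) * g) \<le> S * (g powr p + (p - 1) * W)"
    unfolding W_def S_def using x p g0 by (intro mult_left_mono powr_tangent) auto
  moreover have "(p - 1) * W * (S' - S) = p * S' * W - S' * W - (p - 1) * S * W"
    and "S * (g powr p + (p - 1) * W) = S * g powr p + (p - 1) * S * W"
    by (simp_all add: algebra_simps)
  ultimately show ?thesis using a b unfolding S_def[symmetric] S'_def[symmetric] W_def[symmetric]
    by linarith
qed

lemma energy_chain:
  assumes pr: "convex_profile \<phi>" "convex_profile \<psi>" and p: "1 < p"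
    and i: "\<And>y. (\<lambda>t. \<phi> t powr p) integrable_on {0..y}" "\<And>y. (\<lambda>t. \<psi> t powr p) integrable_on {0..y}"
    and k: "0 < k1" "0 < k2" "k1 + k2 = 2" "(p - 1) * (k2 - k1) = K"
    and h: "0 < h" and v: "\<And>n. 0 \<le> v n" "\<And>n. v n \<le> v (Suc n)"
  shows "2 * (v n + real (Suc n) * h) * window_mean \<phi> \<psi> (real (Suc n) * h) (v n) powr p
      + (\<Sum>j\<le>n. K * h * window_mean \<phi> \<psi> (real (Suc j) * h) (v j) powr p)
    \<le> k1 powr (1 - p) * primitive (\<lambda>t. \<phi> t powr p) (v n + 2 * (real (Suc n) * h))
      + k2 powr (1 - p) * primitive (\<lambda>t. \<psi> t powr p) (v n)"
proof -
  note step = energy_step[OF pr p i k]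
  have g: "2 * (v n + real (Suc n) * h) * window_mean \<phi> \<psi> (real (Suc n) * h) (v n)
      = primitive \<phi> (v n + 2 * (real (Suc n) * h)) + primitive \<psi> (v n)"
    "0 \<le> window_mean \<phi> \<psi> (real (Suc n) * h) (v n)" for n
  proof -
    have "0 < v n + real (Suc n) * h" using h v(1)[of n] by (intro add_nonneg_pos) auto
    then show "2 * (v n + real (Suc n) * h) * window_mean \<phi> \<psi> (real (Suc n) * h) (v n)
      = primitive \<phi> (v n + 2 * (real (Suc n) * h)) + primitive \<psi> (v n)" by (simp add: window_mean_def)
    show "0 \<le> window_mean \<phi> \<psi> (real (Suc n) * h) (v n)" using h v by (intro window_mean_nonneg pr) auto
  qed
  show ?thesis
  proof (induction n)
    case 0
    show ?case
      using step[of 0 "real (Suc 0) * h" 0 "v 0" 0, OF _ _ _ _ _ g(2)[of 0] _ g(1)[of 0]] h v by simp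
  next
    case (Suc n)
    have d: "real (Suc (Suc n)) * h - real (Suc n) * h = h" by (simp add: algebra_simps)
    have "2 * (v (Suc n) + real (Suc (Suc n)) * h) * window_mean \<phi> \<psi> (real (Suc (Suc n)) * h) (v (Suc n)) powr p
      - 2 * (v n + real (Suc n) * h) * window_mean \<phi> \<psi> (real (Suc n) * h) (v n) powr p
      + K * h * window_mean \<phi> \<psi> (real (Suc (Suc n)) * h) (v (Suc n)) powr p
      \<le> k1 powr (1 - p) * (primitive (\<lambda>t. \<phi> t powr p) (v (Suc n) + 2 * (real (Suc (Suc n)) * h))
          - primitive (\<lambda>t. \<phi> t powr p) (v n + 2 * (real (Suc n) * h)))
      + k2 powr (1 - p) * (primitive (\<lambda>t. \<psi> t powr p) (v (Suc n)) - primitive (\<lambda>t. \<psi> t powr p) (v n))"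
      using step[OF _ _ v(1)[of n] v(2)[of n] g(2)[of n] g(2)[of "Suc n"] g(1)[of n] g(1)[of "Suc n"]] h
      unfolding d by (simp add: mult_right_mono)
    with Suc.IH show ?case by (simp add: algebra_simps)
  qed
qed

definition best_mean :: "(real \<Rightarrow> real) \<Rightarrow> (real \<Rightarrow> real) \<Rightarrow> real \<Rightarrow> real \<Rightarrow> real" where
  "best_mean \<phi> \<psi> V x = (SUP v\<in>{0..V}. window_mean \<phi> \<psi> x v)"

lemma best_mean_eq: "is_best \<phi> \<psi> V x v \<Longrightarrow> best_mean \<phi> \<psi> V x = window_mean \<phi> \<psi> x v"
  unfolding best_mean_def is_best_def by (intro cSup_eq_maximum) auto

text \<open>Shrinking an optimal window towards the peak by a factor l \<le> 1 does not decrease its mean and keeps it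
admissible.\<close>

lemma best_mean_antimono:
  assumes p: "convex_profile \<phi>" "convex_profile \<psi>" "antimono_on {0<..} \<phi>" "antimono_on {0<..} \<psi>"
    and x: "0 < x" "x \<le> x'" "0 \<le> V"
  shows "best_mean \<phi> \<psi> V x' \<le> best_mean \<phi> \<psi> V x"
proof -
  obtain v where v: "is_best \<phi> \<psi> V x v" using ex_best[OF p(1,2), of x V] x by auto
  obtain v' where v': "is_best \<phi> \<psi> V x' v'" using ex_best[OF p(1,2), of x' V] x by auto
  define l where "l = x / x'"
  have l: "0 < l" "l \<le> 1" "l * x' = x" using x by (auto simp: l_def)
  have "l * v' \<in> {0..V}" using v' l mult_left_le_one_le[of v' l] by (auto simp: is_best_def)
  then have "window_mean \<phi> \<psi> x (l * v') \<le> window_mean \<phi> \<psi> x v" using v by (auto simp: is_best_def)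
  moreover have "window_mean \<phi> \<psi> x' v' \<le> window_mean \<phi> \<psi> (l * x') (l * v')"
    using v' x l by (intro window_mean_scale p) (auto simp: is_best_def)
  ultimately show ?thesis using l best_mean_eq[OF v] best_mean_eq[OF v'] by simp
qed

lemma best_mean_nonneg:
  assumes p: "convex_profile \<phi>" "convex_profile \<psi>" and x: "0 < x" "0 \<le> V"
  shows "0 \<le> best_mean \<phi> \<psi> V x"
proof -
  obtain v where v: "is_best \<phi> \<psi> V x v" using ex_best[OF p(1,2), of x V] x by auto
  then show ?thesis using best_mean_eq[OF v] window_mean_nonneg[OF p x(1), of v] by (auto simp: is_best_def)
qed

lemma window_mean_le_best_mean:
  assumes p: "convex_profile \<phi>" "convex_profile \<psi>" and x: "0 < x" "0 \<le> v" "v \<le> V"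
  shows "window_mean \<phi> \<psi> x v \<le> best_mean \<phi> \<psi> V x"
proof -
  obtain w where w: "is_best \<phi> \<psi> V x w" using ex_best[OF p(1,2), of x V] x by auto
  then show ?thesis using best_mean_eq[OF w] x by (auto simp: is_best_def)
qed

lemma best_mean_mono:
  assumes p: "convex_profile \<phi>" "convex_profile \<psi>" and x: "0 < x" "0 \<le> V" "V \<le> V'"
  shows "best_mean \<phi> \<psi> V x \<le> best_mean \<phi> \<psi> V' x"
proof -
  obtain w where w: "is_best \<phi> \<psi> V x w" using ex_best[OF p(1,2), of x V] x by auto
  then show ?thesis using best_mean_eq[OF w] window_mean_le_best_mean[OF p x(1), of w V'] x
    by (auto simp: is_best_def)
qed

lemma best_mean_grid:
  assumes p: "convex_profile \<phi>" "convex_profile \<psi>" "antimono_on {0<..} \<phi>" "antimono_on {0<..} \<psi>"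
    and "1 < p"
    and i: "\<And>y. (\<lambda>t. \<phi> t powr p) integrable_on {0..y}" "\<And>y. (\<lambda>t. \<psi> t powr p) integrable_on {0..y}"
    and k: "0 < k1" "0 < k2" "k1 + k2 = 2" "(p - 1) * (k2 - k1) = K"
    and R: "\<And>y. 0 \<le> y \<Longrightarrow> primitive (\<lambda>t. \<phi> t powr p) y \<le> R1" "\<And>y. 0 \<le> y \<Longrightarrow> primitive (\<lambda>t. \<psi> t powr p) y \<le> R2"
    and h: "0 < h" "0 \<le> V"
  shows "(\<Sum>j\<le>n. K * h * best_mean \<phi> \<psi> V (real (Suc j) * h) powr p)
    \<le> k1 powr (1 - p) * R1 + k2 powr (1 - p) * R2"
proof -
  obtain v where v: "\<And>n::nat. is_best \<phi> \<psi> V (real (Suc n) * h) (v n)" "\<And>n. v n \<le> v (Suc n)"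
    using ex_monotone_best[OF p h] by blast
  have v0: "0 \<le> v n" for n using v(1)[of n] by (auto simp: is_best_def)
  have "(\<Sum>j\<le>n. K * h * best_mean \<phi> \<psi> V (real (Suc j) * h) powr p)
      = (\<Sum>j\<le>n. K * h * window_mean \<phi> \<psi> (real (Suc j) * h) (v j) powr p)"
    using best_mean_eq[OF v(1)] by simp
  also have "\<dots> \<le> 2 * (v n + real (Suc n) * h) * window_mean \<phi> \<psi> (real (Suc n) * h) (v n) powr p
      + (\<Sum>j\<le>n. K * h * window_mean \<phi> \<psi> (real (Suc j) * h) (v j) powr p)"
    using v0[of n] h by simp
  also have "\<dots> \<le> k1 powr (1 - p) * primitive (\<lambda>t. \<phi> t powr p) (v n + 2 * (real (Suc n) * h))
      + k2 powr (1 - p) * primitive (\<lambda>t. \<psi> t powr p) (v n)"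
    using energy_chain[where v = v and n = n, OF p(1,2) assms(5) i k h(1)] v0 v(2) by blast
  also have "\<dots> \<le> k1 powr (1 - p) * R1 + k2 powr (1 - p) * R2"
    using v0[of n] h by (intro add_mono mult_left_mono R) auto
  finally show ?thesis .
qed

section \<open>The critical ratio and the constant\<close>

lemma powr_tangent_concave:
  fixes y y0 q :: real
  assumes "0 < q" "q < 1" "0 \<le> y" "0 < y0"
  shows "y powr q \<le> y0 powr q + q * y0 powr (q - 1) * (y - y0)"
proof -
  have "1 / q * (y0 powr q) powr (1 / q - 1) * y powr q
      \<le> (y powr q) powr (1 / q) + (1 / q - 1) * (y0 powr q) powr (1 / q)"
    using assms by (intro powr_tangent) auto
  then have "1 / q * y0 powr (1 - q) * y powr q \<le> y + (1 / q - 1) * y0"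
    using assms by (simp add: powr_powr right_diff_distrib)
  then have "(q * y0 powr (q - 1)) * (1 / q * y0 powr (1 - q) * y powr q)
      \<le> (q * y0 powr (q - 1)) * (y + (1 / q - 1) * y0)"
    using assms by (intro mult_left_mono) auto
  moreover have "(q * y0 powr (q - 1)) * (1 / q * y0 powr (1 - q) * y powr q) = y powr q"
  proof -
    have "y0 powr (q - 1) * y0 powr (1 - q) = 1" using assms by (simp add: powr_add[symmetric])
    then show ?thesis using assms by (simp add: field_simps)
  qed
  moreover have "y0 powr q = y0 powr (q - 1) * y0"
    using powr_mult_base[of y0 "q - 1"] assms by (simp add: mult.commute)
  then have "(q * y0 powr (q - 1)) * (y + (1 / q - 1) * y0) = y0 powr q + q * y0 powr (q - 1) * (y - y0)"
    using assms by (simp add: field_simps)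
  ultimately show ?thesis by simp
qed

text \<open>The two equations say that \<tau> is a critical point of peak_quotient p with value c. Their quotient is a single
equation, solved by the intermediate value theorem on [1, p].\<close>

lemma ex_critical:
  fixes p :: real
  assumes p: "1 < p"
  obtains \<tau> c where "1 < \<tau>" "\<tau> < p" "0 < c"
    "(\<tau> + 1) powr (- 1 / p) = c * (1 - \<tau> / p)" "(\<tau> - 1) powr (- 1 / p) = c * (1 + \<tau> / p)"
proof -
  define h where "h \<tau> = (\<tau> - 1) powr (1 / p) * (p + \<tau>) - (\<tau> + 1) powr (1 / p) * (p - \<tau>)" for \<tau> :: real
  have "continuous_on {1..p} h" unfolding h_def
    using p by (auto intro!: continuous_intros continuous_on_powr')
  moreover have "h 1 \<le> 0" "0 \<le> h p" using p by (auto simp: h_def)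
  ultimately obtain \<tau> where t: "1 \<le> \<tau>" "\<tau> \<le> p" "h \<tau> = 0"
    using IVT'[of h 1 0 p] p by auto
  have "h 1 < 0" using p by (simp add: h_def)
  moreover have "0 < h p" using p by (simp add: h_def)
  ultimately have t': "1 < \<tau>" "\<tau> < p" using t by (metis less_le less_irrefl)+
  define c where "c = (\<tau> + 1) powr (- 1 / p) / (1 - \<tau> / p)"
  have pos: "0 < 1 - \<tau> / p" using t' p by simp
  have inv: "x powr (- 1 / p) = 1 / x powr (1 / p)" for x :: real
    by (simp add: powr_minus_divide minus_divide_left[symmetric])
  have "(\<tau> - 1) powr (1 / p) * (p + \<tau>) = (\<tau> + 1) powr (1 / p) * (p - \<tau>)" using t by (simp add: h_def)
  then have "1 / (\<tau> - 1) powr (1 / p) * (p - \<tau>) = 1 / (\<tau> + 1) powr (1 / p) * (p + \<tau>)"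
    using t' by (simp add: field_simps)
  then have "(\<tau> - 1) powr (- 1 / p) * (p - \<tau>) = (\<tau> + 1) powr (- 1 / p) * (p + \<tau>)" by (simp only: inv)
  then have "(\<tau> - 1) powr (- 1 / p) = c * (1 + \<tau> / p)"
    using t' p by (simp add: c_def field_simps)
  moreover have "(\<tau> + 1) powr (- 1 / p) = c * (1 - \<tau> / p)"
    by (metis c_def less_irrefl nonzero_eq_divide_eq pos)
  moreover have "0 < c" using pos t' unfolding c_def by (intro divide_pos_pos) auto
  ultimately show ?thesis using that t' by blast
qed

context
  fixes p \<tau> c :: real
  assumes p: "1 < p" and \<tau>: "1 < \<tau>" "\<tau> < p" and c: "0 < c"
    and crit: "(\<tau> + 1) powr (- 1 / p) = c * (1 - \<tau> / p)" "(\<tau> - 1) powr (- 1 / p) = c * (1 + \<tau> / p)"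
begin

lemma critical_powr:
  "(\<tau> + 1) powr ((p - 1) / p) = c * (1 - \<tau> / p) * (\<tau> + 1)"
  "(\<tau> - 1) powr ((p - 1) / p) = c * (1 + \<tau> / p) * (\<tau> - 1)"
proof -
  have q: "(p - 1) / p = 1 + - 1 / p" using p by (simp add: field_simps)
  show "(\<tau> + 1) powr ((p - 1) / p) = c * (1 - \<tau> / p) * (\<tau> + 1)"
    unfolding crit(1)[symmetric] q using \<tau> by (subst powr_add) simp
  show "(\<tau> - 1) powr ((p - 1) / p) = c * (1 + \<tau> / p) * (\<tau> - 1)"
    unfolding crit(2)[symmetric] q using \<tau> by (subst powr_add) simp
qed

lemma critical_sum:
  "(\<tau> + 1) powr ((p - 1) / p) + (\<tau> - 1) powr ((p - 1) / p) = c * (2 * \<tau> * ((p - 1) / p))"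
  unfolding critical_powr using p by (simp add: field_simps)

lemma peak_quotient_critical: "peak_quotient p \<tau> = c"
  unfolding peak_quotient_def critical_sum using p \<tau> by simp

text \<open>The numerator of peak_quotient is concave, and by the critical equations its tangent at \<tau> is the line
s \<mapsto> 2 c s (p - 1) / p through the origin; dividing by the denominator leaves c.\<close>

lemma peak_quotient_le_critical:
  assumes "1 \<le> s" shows "peak_quotient p s \<le> c"
proof -
  define q where "q = (p - 1) / p"
  have q: "0 < q" "q < 1" "q - 1 = - 1 / p" using p by (auto simp: q_def field_simps)
  have "(s + 1) powr q \<le> (\<tau> + 1) powr q + q * (\<tau> + 1) powr (q - 1) * (s + 1 - (\<tau> + 1))"
    using q assms \<tau> by (intro powr_tangent_concave) auto
  moreover have "(s - 1) powr q \<le> (\<tau> - 1) powr q + q * (\<tau> - 1) powr (q - 1) * (s - 1 - (\<tau> - 1))"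
    using q assms \<tau> by (intro powr_tangent_concave) auto
  ultimately have "(s + 1) powr q + (s - 1) powr q
      \<le> c * (2 * \<tau> * q) + (q * (c * (1 - \<tau> / p)) * (s - \<tau>) + q * (c * (1 + \<tau> / p)) * (s - \<tau>))"
    using critical_sum[folded q_def] unfolding q(3) crit by simp
  also have "\<dots> = c * (2 * s * q)" by (simp add: algebra_simps)
  finally show ?thesis
    unfolding peak_quotient_def q_def[symmetric] using q assms by (simp add: pos_divide_le_eq)
qed

lemma peak_const_critical: "peak_const p = c"
  unfolding peak_const_def
proof (rule cSup_eq_maximum)
  show "c \<in> peak_quotient p ` {1<..}" using peak_quotient_critical \<tau> by force
qed (auto intro: peak_quotient_le_critical)

text \<open>The critical equations identify the weights k1^(1-p) and k2^(1-p) with c^(p-1) times the two terms of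
the numerator of peak_quotient.\<close>

lemma critical_weights:
  "(1 - \<tau> / p) powr (1 - p) + (1 + \<tau> / p) powr (1 - p) = (p - 1) * (2 * \<tau> / p) * c powr p"
proof -
  have e: "- 1 / p * (1 - p) = (p - 1) / p" using p by (simp add: field_simps)
  have "c powr (1 - p) * (1 - \<tau> / p) powr (1 - p) = (\<tau> + 1) powr ((p - 1) / p)"
    using arg_cong[OF crit(1), of "\<lambda>x. x powr (1 - p)"] c p \<tau> by (simp only: powr_powr e powr_mult)
  moreover have "c powr (1 - p) * (1 + \<tau> / p) powr (1 - p) = (\<tau> - 1) powr ((p - 1) / p)"
    using arg_cong[OF crit(2), of "\<lambda>x. x powr (1 - p)"] c p \<tau> by (simp only: powr_powr e powr_mult)
  ultimately have "c powr (1 - p) * ((1 - \<tau> / p) powr (1 - p) + (1 + \<tau> / p) powr (1 - p))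
      = c * (2 * \<tau> * ((p - 1) / p))" using critical_sum by (simp add: distrib_left)
  then have "c powr (p - 1) * (c powr (1 - p) * ((1 - \<tau> / p) powr (1 - p) + (1 + \<tau> / p) powr (1 - p)))
      = (c powr (p - 1) * c) * (2 * \<tau> * ((p - 1) / p))" by simp
  moreover have "c powr (p - 1) * c = c powr p" using powr_mult_base[of c "p - 1"] c by (simp add: mult.commute)
  moreover have "c powr (p - 1) * c powr (1 - p) = 1" using c by (simp add: powr_add[symmetric])
  ultimately show ?thesis by (simp add: mult.assoc[symmetric])
qed

end

section \<open>From grids to the half line\<close>

lemma ennpow_ennreal [simp]: "0 \<le> r \<Longrightarrow> ennpow (ennreal r) a = ennreal (r powr a)"
  by (simp add: ennpow_def)

lemma ennpow_top [simp]: "ennpow top a = top"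
  by (simp add: ennpow_def)

lemma ennpow_mono: "0 \<le> a \<Longrightarrow> x \<le> y \<Longrightarrow> ennpow x a \<le> ennpow y a"
  by (cases x; cases y) (auto simp: top_unique intro!: ennreal_leI powr_mono2)

lemma ennpow_ennpow: "0 < a \<Longrightarrow> ennpow (ennpow x a) (1 / a) = x"
  by (cases x) (auto simp: powr_powr)

lemma ennpow_ennpow': "0 < a \<Longrightarrow> ennpow (ennpow x (1 / a)) a = x"
  by (cases x) (auto simp: powr_powr)

lemma ennpow_0 [simp]: "ennpow 0 a = 0"
  by (simp add: ennpow_def)

lemma ennpow_mult:
  assumes "0 \<le> r" "0 < a"
  shows "ennpow (ennreal r * x) a = ennreal (r powr a) * ennpow x a"
proof (cases x)
  case (real s)
  then have "ennreal r * x = ennreal (r * s)" using assms by (simp add: ennreal_mult)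
  moreover have "ennreal ((r * s) powr a) = ennreal (r powr a) * ennreal (s powr a)"
    using assms real by (simp add: powr_mult ennreal_mult)
  ultimately show ?thesis using assms real by simp
next
  case top
  then show ?thesis using assms by (cases "r = 0") (auto simp: ennreal_mult_top)
qed

text \<open>The map x \<mapsto> x^a has a monotone inverse, so no continuity argument is needed.\<close>

lemma ennpow_SUP_le:
  assumes "0 < a"
  shows "ennpow (SUP i\<in>I. f i) a \<le> (SUP i\<in>I. ennpow (f i) a)"
proof -
  let ?S = "SUP i\<in>I. ennpow (f i) a"
  have "f i \<le> ennpow ?S (1 / a)" if "i \<in> I" for i
  proof -
    have "f i = ennpow (ennpow (f i) a) (1 / a)" using assms by (simp add: ennpow_ennpow)
    also have "\<dots> \<le> ennpow ?S (1 / a)" using assms that by (intro ennpow_mono SUP_upper) auto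
    finally show ?thesis .
  qed
  then have "(SUP i\<in>I. f i) \<le> ennpow ?S (1 / a)" by (rule SUP_least)
  then have "ennpow (SUP i\<in>I. f i) a \<le> ennpow (ennpow ?S (1 / a)) a"
    using assms by (intro ennpow_mono) auto
  then show ?thesis using assms by (simp add: ennpow_ennpow')
qed

lemma measurable_ennpow [measurable (raw)]:
  assumes [measurable]: "f \<in> borel_measurable M"
  shows "(\<lambda>x. ennpow (f x) a) \<in> borel_measurable M"
  unfolding ennpow_def by measurable

lemma borel_measurable_best_mean:
  assumes p: "convex_profile \<phi>" "convex_profile \<psi>" "antimono_on {0<..} \<phi>" "antimono_on {0<..} \<psi>"
    and V: "0 \<le> V"
  shows "(\<lambda>x. if 0 < x then best_mean \<phi> \<psi> V x else 0) \<in> borel_measurable borel"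
proof -
  have "(\<lambda>x. if 0 < x then - best_mean \<phi> \<psi> V x else 0) \<in> borel_measurable borel"
    by (rule borel_measurable_piecewise_mono[of "{{0<..}, {..0}}"])
       (use best_mean_antimono[OF p _ _ V] in \<open>auto simp: monotone_on_def\<close>)
  then have "(\<lambda>x. - (if 0 < x then - best_mean \<phi> \<psi> V x else 0)) \<in> borel_measurable borel" by measurable
  then show ?thesis by (rule back_subst[of "\<lambda>f. f \<in> borel_measurable borel"]) auto
qed

text \<open>A decreasing function is dominated by the step function that takes on each cell the value at the left
end, which is the quantity controlled by the energy inequality.\<close>

lemma nn_integral_step_bound:
  fixes f :: "real \<Rightarrow> real"
  assumes f: "\<And>x y. 0 < x \<Longrightarrow> x \<le> y \<Longrightarrow> f y \<le> f x" "\<And>x. 0 < x \<Longrightarrow> 0 \<le> f x" and h: "0 < h"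
    and b: "b \<le> real (Suc (Suc N)) * h"
  shows "(\<integral>\<^sup>+x\<in>{h..<b}. ennreal (f x) \<partial>lborel) \<le> ennreal (\<Sum>j\<le>N. h * f (real (Suc j) * h))"
proof -
  define I where "I j = {real (Suc j) * h .. real (Suc (Suc j)) * h}" for j
  have "(\<integral>\<^sup>+x\<in>{h..<b}. ennreal (f x) \<partial>lborel)
      \<le> (\<integral>\<^sup>+x. (\<Sum>j\<le>N. ennreal (f (real (Suc j) * h)) * indicator (I j) x) \<partial>lborel)"
  proof (rule nn_integral_mono)
    fix x :: real
    show "ennreal (f x) * indicator {h..<b} x \<le> (\<Sum>j\<le>N. ennreal (f (real (Suc j) * h)) * indicator (I j) x)"
    proof (cases "x \<in> {h..<b}")
      case True
      define m where "m = nat \<lfloor>x / h\<rfloor>"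
      have xh: "1 \<le> x / h" using True h by simp
      have m1: "1 \<le> m" using xh by (simp add: m_def le_nat_iff)
      have m: "real m \<le> x / h" "x / h < real m + 1" using xh by (auto simp: m_def)
      have "x / h < real (Suc (Suc N))" using True b h by (simp add: pos_divide_less_eq) 
      then have "real m < real (Suc (Suc N))" using m by linarith
      then have "m < Suc (Suc N)" by (simp only: of_nat_less_iff)
      then obtain j where j: "m = Suc j" "j \<le> N" using m1 by (cases m) auto
      have "real (Suc j) * h \<le> x" "x \<le> real (Suc (Suc j)) * h"
        using m h j by (auto simp: field_simps)
      then have xI: "x \<in> I j" and le: "f x \<le> f (real (Suc j) * h)" using h by (auto simp: I_def intro!: f)
      have "ennreal (f x) * indicator {h..<b} x \<le> ennreal (f (real (Suc j) * h)) * indicator (I j) x"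
        using True xI le by (simp add: ennreal_leI)
      also have "\<dots> \<le> (\<Sum>j\<le>N. ennreal (f (real (Suc j) * h)) * indicator (I j) x)"
        using j by (intro member_le_sum) auto
      finally show ?thesis .
    qed simp
  qed
  also have "\<dots> = (\<Sum>j\<le>N. ennreal (f (real (Suc j) * h)) * emeasure lborel (I j))"
    by (subst nn_integral_sum) (auto simp: I_def nn_integral_cmult)
  also have "\<dots> = (\<Sum>j\<le>N. ennreal (h * f (real (Suc j) * h)))"
  proof (rule sum.cong[OF refl])
    fix j
    have "emeasure lborel (I j) = ennreal h" using h by (simp add: I_def algebra_simps)
    then show "ennreal (f (real (Suc j) * h)) * emeasure lborel (I j) = ennreal (h * f (real (Suc j) * h))"
      using f(2)[of "real (Suc j) * h"] h by (simp add: ennreal_mult[symmetric] mult.commute)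
  qed
  also have "\<dots> = ennreal (\<Sum>j\<le>N. h * f (real (Suc j) * h))"
    using f(2) h by (intro sum_ennreal) auto
  finally show ?thesis .
qed

text \<open>The grid is refined and V is increased simultaneously, with mesh h n and V = n, so that monotone
convergence is applied only once.\<close>

lemma half_line_bound:
  assumes p: "convex_profile \<phi>" "convex_profile \<psi>" "antimono_on {0<..} \<phi>" "antimono_on {0<..} \<psi>"
    and p1: "1 < p"
    and i: "\<And>y. (\<lambda>t. \<phi> t powr p) integrable_on {0..y}" "\<And>y. (\<lambda>t. \<psi> t powr p) integrable_on {0..y}"
    and k: "0 < k1" "0 < k2" "k1 + k2 = 2" "(p - 1) * (k2 - k1) = K" and K: "0 < K"
    and R: "\<And>y. 0 \<le> y \<Longrightarrow> primitive (\<lambda>t. \<phi> t powr p) y \<le> R1" "\<And>y. 0 \<le> y \<Longrightarrow> primitive (\<lambda>t. \<psi> t powr p) y \<le> R2"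
  shows "(\<integral>\<^sup>+x\<in>{0<..}. ennpow (SUP n. ennreal (best_mean \<phi> \<psi> (real n) x)) p \<partial>lborel)
    \<le> ennreal ((k1 powr (1 - p) * R1 + k2 powr (1 - p) * R2) / K)"
proof -
  let ?R = "(k1 powr (1 - p) * R1 + k2 powr (1 - p) * R2) / K"
  define h where "h n = inverse (real (Suc n))" for n
  define g where "g n x = ennreal (best_mean \<phi> \<psi> (real n) x powr p) * indicator {h n..<real n} x" for n x
  have h0: "0 < h n" for n by (simp add: h_def)
  have meas: "g n \<in> borel_measurable lborel" for n
  proof -
    note [measurable] = borel_measurable_best_mean[OF p, of "real n"]
    have "(\<lambda>x. ennreal ((if 0 < x then best_mean \<phi> \<psi> (real n) x else 0) powr p) * indicator {h n..<real n} x)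
      \<in> borel_measurable lborel" by measurable
    moreover have "(\<lambda>x. ennreal ((if 0 < x then best_mean \<phi> \<psi> (real n) x else 0) powr p) * indicator {h n..<real n} x) = g n"
      using h0[of n] by (auto simp: g_def fun_eq_iff split: split_indicator)
    ultimately show ?thesis by simp
  qed
  have inc: "incseq g"
  proof (rule incseq_SucI, rule le_funI)
    fix n x
    have "h (Suc n) \<le> h n" by (simp add: h_def divide_simps)
    moreover have "best_mean \<phi> \<psi> (real n) x powr p \<le> best_mean \<phi> \<psi> (real (Suc n)) x powr p" if "0 < x"
      using that p1 by (intro powr_mono2 best_mean_mono best_mean_nonneg p) auto
    ultimately show "g n x \<le> g (Suc n) x"
      using h0[of n] by (auto simp: g_def ennreal_leI split: split_indicator)
  qed
  have bound: "(\<integral>\<^sup>+x. g n x \<partial>lborel) \<le> ennreal ?R" for n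
  proof -
    define N where "N = n * Suc n"
    have Nh: "real (Suc (Suc N)) * h n = real n + 2 * h n"
      by (simp add: N_def h_def field_simps)
    have "(\<integral>\<^sup>+x. g n x \<partial>lborel) \<le> ennreal (\<Sum>j\<le>N. h n * best_mean \<phi> \<psi> (real n) (real (Suc j) * h n) powr p)"
      unfolding g_def
    proof (rule nn_integral_step_bound)
      show "real n \<le> real (Suc (Suc N)) * h n" unfolding Nh using h0[of n] by simp
    qed (use p1 h0 in \<open>auto intro!: powr_mono2 best_mean_antimono best_mean_nonneg p\<close>)
    also have "\<dots> \<le> ennreal ?R"
    proof (rule ennreal_leI)
      have "K * (\<Sum>j\<le>N. h n * best_mean \<phi> \<psi> (real n) (real (Suc j) * h n) powr p)
        = (\<Sum>j\<le>N. K * h n * best_mean \<phi> \<psi> (real n) (real (Suc j) * h n) powr p)"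
        by (simp add: sum_distrib_left mult.assoc)
      also have "\<dots> \<le> k1 powr (1 - p) * R1 + k2 powr (1 - p) * R2"
        by (rule best_mean_grid[OF p p1 i k R h0]) auto
      finally show "(\<Sum>j\<le>N. h n * best_mean \<phi> \<psi> (real n) (real (Suc j) * h n) powr p) \<le> ?R"
        using K by (simp add: pos_le_divide_eq mult.commute)
    qed
    finally show ?thesis .
  qed
  have "(\<integral>\<^sup>+x\<in>{0<..}. ennpow (SUP n. ennreal (best_mean \<phi> \<psi> (real n) x)) p \<partial>lborel)
      \<le> (\<integral>\<^sup>+x. (SUP n. g n x) \<partial>lborel)"
  proof (rule nn_integral_mono)
    fix x :: real
    show "ennpow (SUP n. ennreal (best_mean \<phi> \<psi> (real n) x)) p * indicator {0<..} x \<le> (SUP n. g n x)"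
    proof (cases "0 < x")
      case True
      obtain n0 where n0: "h n0 < x" using reals_Archimedean[OF True] by (auto simp: h_def)
      obtain n1 where n1: "x < real n1" using reals_Archimedean2 by blast
      have "ennpow (SUP n. ennreal (best_mean \<phi> \<psi> (real n) x)) p
          \<le> (SUP n. ennpow (ennreal (best_mean \<phi> \<psi> (real n) x)) p)"
        using p1 by (intro ennpow_SUP_le) auto
      also have "\<dots> \<le> (SUP n. g n x)"
      proof (rule SUP_mono)
        fix n :: nat
        define m where "m = max n (max n0 n1)"
        have "h m \<le> h n0" by (simp add: h_def m_def divide_simps)
        then have "x \<in> {h m..<real m}" using n0 n1 by (auto simp: m_def)
        then have "g m x = ennreal (best_mean \<phi> \<psi> (real m) x powr p)" by (simp add: g_def)
        moreover have "best_mean \<phi> \<psi> (real n) x powr p \<le> best_mean \<phi> \<psi> (real m) x powr p"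
          using True p1 by (intro powr_mono2 best_mean_mono best_mean_nonneg p) (auto simp: m_def)
        ultimately show "\<exists>m\<in>UNIV. ennpow (ennreal (best_mean \<phi> \<psi> (real n) x)) p \<le> g m x"
          using best_mean_nonneg[OF p(1,2) True, of "real n"] by (intro bexI[of _ m], simp_all add: ennreal_leI)
      qed
      finally show ?thesis using True by simp
    qed simp
  qed
  also have "\<dots> = (SUP n. \<integral>\<^sup>+x. g n x \<partial>lborel)"
    by (rule nn_integral_monotone_convergence_SUP[OF inc meas])
  also have "\<dots> \<le> ennreal ?R" by (rule SUP_least) (rule bound)
  finally show ?thesis .
qed

section \<open>The maximal function through window means\<close>

text \<open>Compare \<phi> with its chord over the window [x - d, x + d]: inside, \<phi> lies below the chord, outside above it,
and the chord has the same average over every window centred at x.\<close>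

lemma window_mean_centered_le:
  assumes \<phi>: "convex_profile \<phi>" and d: "0 < d" "d < x"
  shows "(primitive \<phi> (x + d) - primitive \<phi> (x - d)) / (2 * d) \<le> primitive \<phi> (2 * x) / (2 * x)"
proof -
  define a b where "a = x - d" and "b = x + d"
  define k where "k = (\<phi> b - \<phi> a) / (b - a)"
  define m where "m = (\<phi> a + \<phi> b) / 2"
  have ab: "0 < a" "a < b" "b - a = 2 * d" "a + b = 2 * x" "b < 2 * x" using d by (auto simp: a_def b_def)
  have above: "\<phi> a + k * (t - a) \<le> \<phi> t" if "0 < t" "t \<notin> {a<..<b}" for t
    unfolding k_def using \<phi> that ab
    by (intro convex_above_chord_extension[of "{0<..}"]) (auto simp: convex_profile_def)
  have "\<phi> a * (a - 0) + k * ((a - a)^2 - (0 - a)^2) / 2 \<le> primitive \<phi> a - primitive \<phi> 0"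
    by (rule has_integral_le_Ioo[OF has_integral_affine primitive_diff[OF \<phi>]]) (use ab above in auto)
  moreover have "\<phi> a * (2 * x - b) + k * ((2 * x - a)^2 - (b - a)^2) / 2 \<le> primitive \<phi> (2 * x) - primitive \<phi> b"
    by (rule has_integral_le_Ioo[OF has_integral_affine primitive_diff[OF \<phi>]]) (use ab above in auto)
  moreover have "(\<phi> a * (a - 0) + k * ((a - a)^2 - (0 - a)^2) / 2)
      + (\<phi> a * (2 * x - b) + k * ((2 * x - a)^2 - (b - a)^2) / 2) = m * (2 * (x - d))"
  proof -
    have "\<phi> b = \<phi> a + k * (2 * d)" using ab d by (simp add: k_def)
    then show ?thesis by (simp add: m_def a_def b_def power2_eq_square algebra_simps add_divide_distrib diff_divide_distrib)
  qed
  ultimately have out: "m * (2 * (x - d)) \<le> primitive \<phi> (2 * x) - (primitive \<phi> b - primitive \<phi> a)" by simp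
  have inn: "primitive \<phi> b - primitive \<phi> a \<le> m * (2 * d)"
    using primitive_diff_trapezoid[OF \<phi>, of a b] ab by (simp add: m_def algebra_simps)
  define I where "I = primitive \<phi> b - primitive \<phi> a"
  have "I * (x - d) \<le> (m * (2 * d)) * (x - d)" using inn d by (intro mult_right_mono) (auto simp: I_def)
  also have "\<dots> = d * (m * (2 * (x - d)))" by simp
  also have "\<dots> \<le> d * (primitive \<phi> (2 * x) - I)" using out d by (intro mult_left_mono) (auto simp: I_def)
  finally have "I * x \<le> d * primitive \<phi> (2 * x)" by (simp add: algebra_simps)
  then show ?thesis using d by (simp add: I_def a_def b_def field_simps)
qed

lemma has_integral_across_peak:
  assumes f: "convex_profile f" "convex_profile (\<lambda>t. f (- t))" and "0 \<le> v" "0 \<le> u"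
  shows "(f has_integral (primitive f u + primitive (\<lambda>t. f (- t)) v)) {- v..u}"
proof -
  have "((\<lambda>t. f (- t)) has_integral primitive (\<lambda>t. f (- t)) v) {0..v}"
    using primitive_diff[OF f(2), of 0 v] assms by simp
  then have "(f has_integral primitive (\<lambda>t. f (- t)) v) {- v..0}"
    using has_integral_reflect_real[of f _ 0 "- v"] by simp
  moreover have "(f has_integral primitive f u) {0..u}" using primitive_diff[OF f(1), of 0 u] assms by simp
  ultimately show ?thesis
    using has_integral_combine[of "- v" 0 u f "primitive (\<lambda>t. f (- t)) v" "primitive f u"] assms by (simp add: add.commute)
qed

lemma window_average:
  assumes f: "\<And>t. 0 \<le> f t" and I: "(f has_integral I) {x - d..x + d}" and d: "0 < d"
  shows "(\<integral>\<^sup>+t\<in>{x - d..x + d}. ennreal \<bar>f t\<bar> \<partial>lebesgue) / ennreal (2 * d) = ennreal (I / (2 * d))"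
proof -
  have "(\<integral>\<^sup>+t\<in>{x - d..x + d}. ennreal \<bar>f t\<bar> \<partial>lebesgue) = ennreal I"
    using nn_integral_has_integral_lebesgue'[OF f I] f by (simp add: nn_integral_completion abs_of_nonneg)
  moreover have "0 \<le> I" using has_integral_nonneg[OF I] f by auto
  ultimately show ?thesis using d by (simp add: divide_ennreal)
qed

lemma maximal_function_eq_SUP_window_mean:
  assumes f: "convex_profile f" "convex_profile (\<lambda>t. f (- t))" and x: "0 < x"
  shows "maximal_function f x = (SUP v\<in>{0..}. ennreal (window_mean f (\<lambda>t. f (- t)) x v))"
    (is "_ = (SUP v\<in>_. ennreal (?m v))")
proof (rule antisym)
  have f0: "\<And>t. 0 \<le> f t" using f by (auto simp: convex_profile_def)
  have wide: "(\<integral>\<^sup>+t\<in>{x - d..x + d}. ennreal \<bar>f t\<bar> \<partial>lebesgue) / ennreal (2 * d) = ennreal (?m (d - x))"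
    if "x \<le> d" for d
  proof -
    have "(f has_integral (primitive f (x + d) + primitive (\<lambda>t. f (- t)) (d - x))) {x - d..x + d}"
      using has_integral_across_peak[OF f, of "d - x" "x + d"] that x by simp
    from window_average[OF f0 this] show ?thesis
      using that x by (simp add: window_mean_def add.commute)
  qed
  show "maximal_function f x \<le> (SUP v\<in>{0..}. ennreal (?m v))"
    unfolding maximal_function_def
  proof (rule SUP_least)
    fix d :: real assume "d \<in> {0<..}"
    then have d: "0 < d" by simp
    show "(\<integral>\<^sup>+t\<in>{x - d..x + d}. ennreal \<bar>f t\<bar> \<partial>lebesgue) / ennreal (2 * d) \<le> (SUP v\<in>{0..}. ennreal (?m v))"
    proof (cases "x \<le> d")
      case True
      then show ?thesis unfolding wide[OF True] by (intro SUP_upper) auto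
    next
      case False
      have "(f has_integral (primitive f (x + d) - primitive f (x - d))) {x - d..x + d}"
        using d False by (intro primitive_diff f) auto
      from window_average[OF f0 this d]
      have "(\<integral>\<^sup>+t\<in>{x - d..x + d}. ennreal \<bar>f t\<bar> \<partial>lebesgue) / ennreal (2 * d)
          = ennreal ((primitive f (x + d) - primitive f (x - d)) / (2 * d))" .
      also have "\<dots> \<le> ennreal (?m 0)"
        using window_mean_centered_le[OF f(1) d] False by (intro ennreal_leI) (simp add: window_mean_def)
      also have "\<dots> \<le> (SUP v\<in>{0..}. ennreal (?m v))" by (intro SUP_upper) auto
      finally show ?thesis .
    qed
  qed
  show "(SUP v\<in>{0..}. ennreal (?m v)) \<le> maximal_function f x"
  proof (rule SUP_least)
    fix v :: real assume v: "v \<in> {0..}"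
    have "ennreal (?m v) = (\<integral>\<^sup>+t\<in>{x - (v + x)..x + (v + x)}. ennreal \<bar>f t\<bar> \<partial>lebesgue) / ennreal (2 * (v + x))"
      using wide[of "v + x"] v by simp
    also have "\<dots> \<le> maximal_function f x"
      unfolding maximal_function_def using v x by (intro SUP_upper) auto
    finally show "ennreal (?m v) \<le> maximal_function f x" .
  qed
qed

lemma maximal_function_le_best_mean:
  assumes f: "convex_profile f" "convex_profile (\<lambda>t. f (- t))" and x: "0 < x"
  shows "maximal_function f x \<le> (SUP n. ennreal (best_mean f (\<lambda>t. f (- t)) (real n) x))"
  unfolding maximal_function_eq_SUP_window_mean[OF assms]
proof (rule SUP_mono)
  fix v :: real assume v: "v \<in> {0..}"
  obtain n where "v \<le> real n" using real_arch_simple by blast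
  then show "\<exists>n\<in>UNIV. ennreal (window_mean f (\<lambda>t. f (- t)) x v) \<le> ennreal (best_mean f (\<lambda>t. f (- t)) (real n) x)"
    using v x by (intro bexI[of _ n] ennreal_leI window_mean_le_best_mean f) auto
qed

lemma maximal_function_affine:
  assumes f: "f \<in> borel_measurable lebesgue" and s: "\<bar>s\<bar> = 1"
  shows "maximal_function (\<lambda>t. f (c + s * t)) x = maximal_function f (c + s * x)"
proof -
  have s0: "s \<noteq> 0" using s by auto
  have "(\<integral>\<^sup>+t\<in>{c + s * x - d..c + s * x + d}. ennreal \<bar>f t\<bar> \<partial>lebesgue)
      = (\<integral>\<^sup>+t\<in>{x - d..x + d}. ennreal \<bar>f (c + s * t)\<bar> \<partial>lebesgue)" for d
  proof -
    have [measurable]: "{c + s * x - d..c + s * x + d} \<in> sets lebesgue" by simp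
    have "(\<lambda>t. ennreal \<bar>f t\<bar> * indicator {c + s * x - d..c + s * x + d} t) \<in> borel_measurable lebesgue"
      using f by measurable
    from nn_integral_real_affine_lebesgue[OF this s0, of c]
    have "(\<integral>\<^sup>+t\<in>{c + s * x - d..c + s * x + d}. ennreal \<bar>f t\<bar> \<partial>lebesgue)
      = (\<integral>\<^sup>+t. ennreal \<bar>f (c + s * t)\<bar> * indicator {c + s * x - d..c + s * x + d} (c + s * t) \<partial>lebesgue)"
      using s by simp
    also have "\<dots> = (\<integral>\<^sup>+t\<in>{x - d..x + d}. ennreal \<bar>f (c + s * t)\<bar> \<partial>lebesgue)"
    proof -
      consider "s = 1" | "s = - 1" using s by linarith
      then have "c + s * t \<in> {c + s * x - d..c + s * x + d} \<longleftrightarrow> t \<in> {x - d..x + d}" for t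
        by cases auto
      then show ?thesis by (intro nn_integral_cong) (auto simp: indicator_def)
    qed
    finally show ?thesis .
  qed
  then show ?thesis unfolding maximal_function_def by simp
qed

text \<open>A convex function that increases somewhere stays bounded away from 0 from then on, which is
incompatible with a finite L^p norm.\<close>

lemma antimono_if_power_integral_bounded:
  assumes \<phi>: "convex_profile \<phi>" and p: "0 < p"
    and i: "\<And>y. (\<lambda>t. \<phi> t powr p) integrable_on {0..y}"
    and R: "\<And>y. 0 \<le> y \<Longrightarrow> primitive (\<lambda>t. \<phi> t powr p) y \<le> R"
  shows "antimono_on {0<..} \<phi>"
proof (rule monotone_onI)
  fix s t :: real assume st: "s \<in> {0<..}" "t \<in> {0<..}" "s \<le> t"
  show "\<phi> t \<le> \<phi> s"
  proof (rule ccontr)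
    assume "\<not> \<phi> t \<le> \<phi> s"
    then have lt: "\<phi> s < \<phi> t" and st': "0 < s" "s < t" using st by (auto simp: less_le)
    have pos: "0 < \<phi> t" using lt \<phi> by (meson convex_profile_def le_less_trans)
    have large: "\<phi> t \<le> \<phi> y" if "t \<le> y" for y
    proof -
      have "\<phi> s + (\<phi> t - \<phi> s) / (t - s) * (y - s) \<le> \<phi> y"
        using \<phi> st' that by (intro convex_above_chord_extension[of "{0<..}"]) (auto simp: convex_profile_def)
      moreover have "(\<phi> t - \<phi> s) / (t - s) * (t - s) \<le> (\<phi> t - \<phi> s) / (t - s) * (y - s)"
        using lt st' that by (intro mult_left_mono) auto
      ultimately show ?thesis using st' by simp
    qed
    \<comment> \<open>Large enough for the constant lower bound to exceed R on [t, y].\<close>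
    define y where "y = t + (\<bar>R\<bar> + 1) / \<phi> t powr p"
    have ty: "t \<le> y" using pos by (simp add: y_def)
    have "\<phi> t powr p * (y - t) \<le> integral {t..y} (\<lambda>t. \<phi> t powr p)"
    proof (rule has_integral_le)
      show "((\<lambda>_. \<phi> t powr p) has_integral \<phi> t powr p * (y - t)) {t..y}"
        using has_integral_const_real[of "\<phi> t powr p" t y] ty by (simp add: mult.commute)
      show "((\<lambda>t. \<phi> t powr p) has_integral integral {t..y} (\<lambda>t. \<phi> t powr p)) {t..y}"
        by (rule integrable_integral, rule integrable_on_subinterval[OF i[of y]]) (use st' in auto)
    qed (use large p pos in \<open>auto intro!: powr_mono2\<close>)
    also have "\<dots> \<le> integral {0..y} (\<lambda>t. \<phi> t powr p)"
      using st' ty by (intro integral_subset_le integrable_on_subinterval[OF i[of y]] i) auto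
    also have "\<dots> \<le> R" using R[of y] ty st' by (simp add: primitive_def)
    finally show False using pos by (simp add: y_def)
  qed
qed

section \<open>The upper bound\<close>

lemma integral_across_peak:
  fixes f :: "real \<Rightarrow> real"
  assumes "f integrable_on {- v..u}" "0 \<le> v" "0 \<le> u"
  shows "integral {- v..u} f = primitive f u + primitive (\<lambda>t. f (- t)) v"
proof -
  have "integral {- v..0} f + integral {0..u} f = integral {- v..u} f"
    using assms by (intro Henstock_Kurzweil_Integration.integral_combine) auto
  moreover have "integral {- v..0} f = primitive (\<lambda>t. f (- t)) v"
    using Henstock_Kurzweil_Integration.integral_reflect_real[of 0 "- v" f] by (simp add: primitive_def)
  ultimately show ?thesis by (simp add: primitive_def)
qed

lemma convex_on_affine:
  fixes f :: "real \<Rightarrow> real"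
  assumes f: "convex_on S f" and T: "convex T" "\<And>t. t \<in> T \<Longrightarrow> c + s * t \<in> S"
  shows "convex_on T (\<lambda>t. f (c + s * t))"
proof (rule convex_onI)
  fix t x y :: real assume t: "0 < t" "t < 1" "x \<in> T" "y \<in> T"
  have "c + s * ((1 - t) *\<^sub>R x + t *\<^sub>R y) = (1 - t) *\<^sub>R (c + s * x) + t *\<^sub>R (c + s * y)"
    by (simp add: algebra_simps)
  then show "f (c + s * ((1 - t) *\<^sub>R x + t *\<^sub>R y)) \<le> (1 - t) * f (c + s * x) + t * f (c + s * y)"
    using convex_onD[OF f, of t "c + s * x" "c + s * y"] t T by simp
qed (rule T)

text \<open>The constants R1 and R2 stand for the integrals of f^p over the two half lines. Taking them as suprema of
the integrals over bounded intervals avoids integrals over unbounded sets.\<close>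

lemma peak_profiles:
  assumes f0: "\<And>t. 0 \<le> f t" and fm: "f \<in> borel_measurable lebesgue" and p: "1 < p"
    and R: "(\<integral>\<^sup>+t. ennreal (f t powr p) \<partial>lebesgue) = ennreal R" "0 \<le> R"
    and conv: "convex_on {0<..} f" "convex_on {..<0} f"
  obtains R1 R2 where "R1 + R2 \<le> R"
    "convex_profile f" "convex_profile (\<lambda>t. f (- t))"
    "antimono_on {0<..} f" "antimono_on {0<..} (\<lambda>t. f (- t))"
    "\<And>y. (\<lambda>t. f t powr p) integrable_on {0..y}" "\<And>y. (\<lambda>t. f (- t) powr p) integrable_on {0..y}"
    "\<And>y. 0 \<le> y \<Longrightarrow> primitive (\<lambda>t. f t powr p) y \<le> R1"
    "\<And>y. 0 \<le> y \<Longrightarrow> primitive (\<lambda>t. f (- t) powr p) y \<le> R2"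
proof -
  let ?P = "\<lambda>t. f t powr p"
  have Pm: "?P \<in> borel_measurable lebesgue" using fm by measurable
  have P: "(?P has_integral R) UNIV"
    using has_integral_iff_nn_integral_lebesgue[of ?P R] Pm R by auto
  then have PU: "?P integrable_on UNIV" by blast
  have Pab: "?P integrable_on {a..b}" for a b using PU by (rule integrable_on_subinterval) auto
  have fab: "f integrable_on {a..b}" for a b
  proof (rule measurable_bounded_by_integrable_imp_integrable_real[of f _ "\<lambda>t. 1 + ?P t"])
    show "f \<in> borel_measurable (lebesgue_on {a..b})" using fm by (rule measurable_restrict_space1)
    show "(\<lambda>t. 1 + ?P t) integrable_on {a..b}" using Pab by (intro integrable_add) auto
    fix t
    show "\<bar>f t\<bar> \<le> 1 + ?P t"
    proof (cases "f t \<le> 1")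
      case False
      then have "f t powr 1 \<le> f t powr p" using p by (intro powr_mono) auto
      then show ?thesis using f0[of t] False by simp
    qed (use f0[of t] in \<open>simp add: add_increasing2\<close>)
  qed simp
  have refl: "(\<lambda>t. h (- t)) integrable_on {0..y}" if "\<And>a b. h integrable_on {a..b}" for h :: "real \<Rightarrow> real" and y
    using that[of "- y" 0] Henstock_Kurzweil_Integration.integrable_reflect_real[of h 0 "- y"] by simp
  have sum: "primitive ?P u + primitive (\<lambda>t. ?P (- t)) v \<le> R" if "0 \<le> u" "0 \<le> v" for u v
  proof -
    have "primitive ?P u + primitive (\<lambda>t. ?P (- t)) v = integral {- v..u} ?P"
      using integral_across_peak[OF Pab[of "- v" u]] that by simp
    also have "\<dots> \<le> integral UNIV ?P" by (intro integral_subset_le Pab PU) auto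
    finally show ?thesis using integral_unique[OF P] by simp
  qed
  define R1 where "R1 = (SUP u\<in>{0..}. primitive ?P u)"
  define R2 where "R2 = (SUP v\<in>{0..}. primitive (\<lambda>t. ?P (- t)) v)"
  have bdd: "bdd_above (primitive ?P ` {0..})" "bdd_above (primitive (\<lambda>t. ?P (- t)) ` {0..})"
    using sum[of _ 0] sum[of 0] by (auto intro!: bdd_aboveI2)
  have R1: "primitive ?P y \<le> R1" if "0 \<le> y" for y
    unfolding R1_def by (rule cSUP_upper[OF _ bdd(1)]) (use that in auto)
  have R2: "primitive (\<lambda>t. ?P (- t)) y \<le> R2" if "0 \<le> y" for y
    unfolding R2_def by (rule cSUP_upper[OF _ bdd(2)]) (use that in auto)
  have "R1 \<le> R - primitive (\<lambda>t. ?P (- t)) v" if "0 \<le> v" for v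
    unfolding R1_def using sum[OF _ that] by (intro cSUP_least) (auto simp: le_diff_eq)
  then have "R2 \<le> R - R1" unfolding R2_def by (intro cSUP_least) (auto simp: le_diff_eq add.commute)
  then have R12: "R1 + R2 \<le> R" by simp
  have "convex_on {0<..} (\<lambda>t. f (0 + - 1 * t))" by (rule convex_on_affine[OF conv(2)]) auto
  then have cp: "convex_profile f" "convex_profile (\<lambda>t. f (- t))"
    using f0 conv fab refl[of f, OF fab] by (auto simp: convex_profile_def)
  show thesis
    using that[OF R12 cp _ _ Pab refl[of ?P, OF Pab] R1 R2] p
      antimono_if_power_integral_bounded[OF cp(1) _ Pab R1]
      antimono_if_power_integral_bounded[OF cp(2) _ refl[of ?P, OF Pab] R2] by auto
qed

text \<open>The majorant H is measurable, which allows the integral to be split at the peak and each half to be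
reflected or translated. The swap of the arguments of half_line_bound on the negative side produces the sum of the two
weights.\<close>

lemma maximal_function_dominated:
  assumes f: "\<And>t. 0 \<le> f t" "f \<in> borel_measurable lebesgue" and p: "1 < p"
    and R: "(\<integral>\<^sup>+t. ennreal (f t powr p) \<partial>lebesgue) = ennreal R" "0 \<le> R"
    and conv: "convex_on {0<..} f" "convex_on {..<0} f"
  obtains H where "H \<in> borel_measurable borel" "\<And>x. x \<noteq> 0 \<Longrightarrow> maximal_function f x \<le> H x"
    "(\<integral>\<^sup>+x. ennpow (H x) p \<partial>lborel) \<le> ennreal (peak_const p powr p * R)"
proof -
  obtain R1 R2 where R12: "R1 + R2 \<le> R"
    and cp: "convex_profile f" "convex_profile (\<lambda>t. f (- t))"
    and anti: "antimono_on {0<..} f" "antimono_on {0<..} (\<lambda>t. f (- t))"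
    and i: "\<And>y. (\<lambda>t. f t powr p) integrable_on {0..y}" "\<And>y. (\<lambda>t. f (- t) powr p) integrable_on {0..y}"
    and b: "\<And>y. 0 \<le> y \<Longrightarrow> primitive (\<lambda>t. f t powr p) y \<le> R1" 
    "\<And>y. 0 \<le> y \<Longrightarrow> primitive (\<lambda>t. f (- t) powr p) y \<le> R2"
    by (rule peak_profiles[OF f p R conv]) blast
  obtain \<tau> c where \<tau>: "1 < \<tau>" "\<tau> < p" and c: "0 < c"
    and crit: "(\<tau> + 1) powr (- 1 / p) = c * (1 - \<tau> / p)" "(\<tau> - 1) powr (- 1 / p) = c * (1 + \<tau> / p)"
    using ex_critical[OF p] by blast
  have pc: "peak_const p = c" by (rule peak_const_critical[OF p \<tau> c crit])
  \<comment> \<open>The ratios f(u) / g and f(-v) / g for the power function and its optimal window.\<close>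
  define k1 where "k1 = 1 - \<tau> / p"
  define k2 where "k2 = 1 + \<tau> / p"
  define K where "K = (p - 1) * (2 * \<tau> / p)"
  have k: "0 < k1" "0 < k2" "k1 + k2 = 2" "(p - 1) * (k2 - k1) = K" "0 < K" 
    using p \<tau> by (auto simp: k1_def k2_def K_def intro!: add_pos_pos)
  have k': "k1 powr (1 - p) + k2 powr (1 - p) = K * c powr p"
    using critical_weights[OF p \<tau> c crit] by (simp add: k1_def k2_def K_def)
  let ?f = "\<lambda>t. f (- t)"
  define D1 where "D1 n x = (if 0 < x then best_mean f ?f (real n) x else 0)" for n x
  define D2 where "D2 n x = (if 0 < x then best_mean ?f f (real n) x else 0)" for n x
  have [measurable]: "D1 n \<in> borel_measurable borel" "D2 n \<in> borel_measurable borel" for n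
    using borel_measurable_best_mean[OF cp anti] borel_measurable_best_mean[OF cp(2,1) anti(2,1)]
    by (auto simp: D1_def[abs_def] D2_def[abs_def])
  define H where "H x = (SUP n. ennreal (D1 n x)) + (SUP n. ennreal (D2 n (- x)))" for x
  have Hm[measurable]: "H \<in> borel_measurable borel" unfolding H_def by measurable
  have pos: "H x = (SUP n. ennreal (best_mean f ?f (real n) x))"
    "H (- x) = (SUP n. ennreal (best_mean ?f f (real n) x))" if "0 < x" for x
    using that by (auto simp: H_def D1_def D2_def)
  have H0: "H 0 = 0" by (simp add: H_def D1_def D2_def)
  have dom: "maximal_function f x \<le> H x" if "x \<noteq> 0" for x
  proof (cases "0 < x")
    case True
    then show ?thesis using maximal_function_le_best_mean[OF cp True] by (simp add: pos)
  next
    case False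
    then have x: "0 < - x" using that by simp
    have "maximal_function f x = maximal_function ?f (- x)"
      using maximal_function_affine[OF f(2), of "- 1" 0 "- x"] by simp
    also have "\<dots> \<le> H (- (- x))"
      using maximal_function_le_best_mean[of ?f, OF cp(2) _ x] cp(1) pos(2)[OF x] by simp
    finally show ?thesis by simp
  qed
  have "(\<integral>\<^sup>+x. ennpow (H x) p \<partial>lborel)
      = (\<integral>\<^sup>+x. ennpow (H x) p * indicator {0<..} x + ennpow (H x) p * indicator {..<0} x \<partial>lborel)"
    by (intro nn_integral_cong) (auto simp: H0 indicator_def not_less less_le)
  also have "\<dots> = (\<integral>\<^sup>+x\<in>{0<..}. ennpow (H x) p \<partial>lborel) + (\<integral>\<^sup>+x\<in>{..<0}. ennpow (H x) p \<partial>lborel)"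
    by (intro nn_integral_add) measurable
  also have "(\<integral>\<^sup>+x\<in>{..<0}. ennpow (H x) p \<partial>lborel) = (\<integral>\<^sup>+x\<in>{0<..}. ennpow (H (- x)) p \<partial>lborel)"
  proof -
    have "(\<lambda>x. ennpow (H x) p * indicator {..<0} x) \<in> borel_measurable borel" by measurable
    from nn_integral_real_affine[OF this, of "- 1" 0] show ?thesis
      by (auto intro!: nn_integral_cong simp: indicator_def)
  qed
  also have "(\<integral>\<^sup>+x\<in>{0<..}. ennpow (H x) p \<partial>lborel)
      = (\<integral>\<^sup>+x\<in>{0<..}. ennpow (SUP n. ennreal (best_mean f ?f (real n) x)) p \<partial>lborel)"
    by (intro nn_integral_cong) (auto simp: pos indicator_def)
  also have "\<dots> \<le> ennreal ((k1 powr (1 - p) * R1 + k2 powr (1 - p) * R2) / K)"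
    by (rule half_line_bound[OF cp anti p i k b])
  also have "(\<integral>\<^sup>+x\<in>{0<..}. ennpow (H (- x)) p \<partial>lborel)
      = (\<integral>\<^sup>+x\<in>{0<..}. ennpow (SUP n. ennreal (best_mean ?f f (real n) x)) p \<partial>lborel)"
    by (intro nn_integral_cong) (auto simp: pos indicator_def)
  also have "\<dots> \<le> ennreal ((k1 powr (1 - p) * R2 + k2 powr (1 - p) * R1) / K)"
    by (rule half_line_bound[OF cp(2,1) anti(2,1) p i(2,1) k b(2,1)])
  finally have "(\<integral>\<^sup>+x. ennpow (H x) p \<partial>lborel)
      \<le> ennreal ((k1 powr (1 - p) * R1 + k2 powr (1 - p) * R2) / K)
        + ennreal ((k1 powr (1 - p) * R2 + k2 powr (1 - p) * R1) / K)" by (simp add: add_mono)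
  also have "\<dots> = ennreal (c powr p * (R1 + R2))"
  proof -
    have nn: "0 \<le> R1" "0 \<le> R2" using b(1)[of 0] b(2)[of 0] by auto
    have "(k1 powr (1 - p) * R1 + k2 powr (1 - p) * R2) / K + (k1 powr (1 - p) * R2 + k2 powr (1 - p) * R1) / K
        = (k1 powr (1 - p) + k2 powr (1 - p)) * (R1 + R2) / K"
      by (simp add: algebra_simps add_divide_distrib)
    also have "\<dots> = c powr p * (R1 + R2)" unfolding k' using k by simp
    finally show ?thesis using nn k by (simp add: ennreal_plus[symmetric] del: ennreal_plus)
  qed
  also have "\<dots> \<le> ennreal (peak_const p powr p * R)"
    unfolding pc using R12 by (intro ennreal_leI mult_left_mono) auto
  finally show thesis using that[OF Hm dom] by simp
qed

lemma Lp_norm_maximal_function_le: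
  assumes p: "1 < p" and f: "f \<in> peak_shaped \<inter> Lp_space p"
  shows "Lp_norm p (maximal_function f) \<le> ennreal (peak_const p) * Lp_norm p (\<lambda>x. ennreal \<bar>f x\<bar>)"
proof -
  have f0: "\<And>t. 0 \<le> f t" and fm: "f \<in> borel_measurable lebesgue"
    using f by (auto simp: peak_shaped_def Lp_space_def)
  obtain a where a: "convex_on {..<a} f" "convex_on {a<..} f" using f by (auto simp: peak_shaped_def)
  have int: "(\<integral>\<^sup>+x. ennpow (ennreal \<bar>f x\<bar>) p \<partial>lebesgue) = (\<integral>\<^sup>+x. ennreal (f x powr p) \<partial>lebesgue)"
    using f0 by simp
  have "Lp_norm p (\<lambda>x. ennreal \<bar>f x\<bar>) \<noteq> top" using f by (auto simp: Lp_space_def)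
  then have "(\<integral>\<^sup>+x. ennreal (f x powr p) \<partial>lebesgue) \<noteq> top"
    unfolding Lp_norm_def int by auto
  then obtain R where R: "(\<integral>\<^sup>+x. ennreal (f x powr p) \<partial>lebesgue) = ennreal R" "0 \<le> R"
    by (metis ennreal_cases)
  have pc: "0 \<le> peak_const p"
    by (metis ex_critical[OF p] peak_const_critical[OF p] less_imp_le)
  define g where "g t = f (a + 1 * t)" for t
  have gm: "g \<in> borel_measurable lebesgue"
    unfolding g_def using measurable_compose[OF lebesgue_affine_measurable[where c="\<lambda>_. 1" and t=a] fm]
    by simp
  have "(\<integral>\<^sup>+t. ennreal (g t powr p) \<partial>lebesgue) = ennreal R"
    using nn_integral_real_affine_lebesgue[of "\<lambda>x. ennreal (f x powr p)" 1 a] fm R by (simp add: g_def)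
  moreover have "convex_on {0<..} g" unfolding g_def by (rule convex_on_affine[OF a(2)]) auto
  moreover have "convex_on {..<0} g" unfolding g_def by (rule convex_on_affine[OF a(1)]) auto
  ultimately obtain H where H[measurable]: "H \<in> borel_measurable borel"
    and dom: "\<And>x. x \<noteq> 0 \<Longrightarrow> maximal_function g x \<le> H x"
    and bound: "(\<integral>\<^sup>+x. ennpow (H x) p \<partial>lborel) \<le> ennreal (peak_const p powr p * R)"
    using maximal_function_dominated[OF _ gm p _ R(2)] f0 by (metis g_def)
  have "(\<integral>\<^sup>+x. ennpow (maximal_function f x) p \<partial>lebesgue) \<le> (\<integral>\<^sup>+x. ennpow (H (- a + 1 * x)) p \<partial>lborel)"
    unfolding nn_integral_completion
  proof (rule nn_integral_mono_AE, rule AE_mp[OF AE_lborel_singleton[of a]], rule AE_I2, rule impI)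
    fix x assume "x \<noteq> a"
    moreover have "maximal_function f x = maximal_function g (x - a)"
      using maximal_function_affine[OF fm, of 1 a "x - a"] unfolding g_def by simp
    ultimately show "ennpow (maximal_function f x) p \<le> ennpow (H (- a + 1 * x)) p"
      using dom[of "x - a"] p by (intro ennpow_mono) auto
  qed
  also have "\<dots> = (\<integral>\<^sup>+x. ennpow (H x) p \<partial>lborel)"
    using nn_integral_real_affine[of "\<lambda>x. ennpow (H x) p" 1 "- a"] by simp
  also note bound
  finally have "ennpow (\<integral>\<^sup>+x. ennpow (maximal_function f x) p \<partial>lebesgue) (1 / p)
      \<le> ennpow (ennreal (peak_const p powr p) * ennreal R) (1 / p)"
    using p R by (intro ennpow_mono) (auto simp: ennreal_mult)
  also have "\<dots> = ennreal ((peak_const p powr p) powr (1 / p)) * ennpow (ennreal R) (1 / p)"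
    using p by (intro ennpow_mult) auto
  also have "(peak_const p powr p) powr (1 / p) = peak_const p" using p pc by (simp add: powr_powr)
  finally show ?thesis unfolding Lp_norm_def int R(1) .
qed

section \<open>Powers\<close>

lemma convex_on_powr_neg:
  fixes a :: real
  assumes "0 < a"
  shows "convex_on {0<..} (\<lambda>t. t powr (- a))"
proof (rule convex_on_realI[where f' = "\<lambda>t. - a * t powr (- a - 1)"])
  fix x y :: real assume "x \<in> {0<..}" "y \<in> {0<..}" "x \<le> y"
  then have "y powr (- a - 1) \<le> x powr (- a - 1)" using assms by (intro powr_mono2') auto
  then show "- a * x powr (- a - 1) \<le> - a * y powr (- a - 1)" using assms by simp
qed (auto intro!: derivative_eq_intros)

lemma convex_on_eq:
  assumes "convex_on S f" "\<And>t. t \<in> S \<Longrightarrow> g t = f t"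
  shows "convex_on S g"
  using assms unfolding convex_on_def by (simp add: convexD)

lemma convex_on_abs_powr_neg:
  fixes a b :: real
  assumes "0 < a" "0 \<le> b"
  shows "convex_on {0<..} (\<lambda>t. (b + \<bar>t\<bar>) powr (- a))" "convex_on {..<0} (\<lambda>t. (b + \<bar>t\<bar>) powr (- a))"
proof -
  have "convex_on {0<..} (\<lambda>t. (b + 1 * t) powr (- a))"
    by (rule convex_on_affine[OF convex_on_powr_neg[OF assms(1)]]) (use assms in auto)
  then show "convex_on {0<..} (\<lambda>t. (b + \<bar>t\<bar>) powr (- a))" by (rule convex_on_eq) auto
  have "convex_on {..<0} (\<lambda>t. (b + - 1 * t) powr (- a))"
    by (rule convex_on_affine[OF convex_on_powr_neg[OF assms(1)]]) (use assms in auto)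
  then show "convex_on {..<0} (\<lambda>t. (b + \<bar>t\<bar>) powr (- a))" by (rule convex_on_eq) auto
qed

lemma powr_neg_profile:
  fixes a b :: real
  assumes a: "0 < a" "a < 1" and b: "0 \<le> b"
  shows "convex_profile (\<lambda>t. (b + \<bar>t\<bar>) powr (- a))"
    and "0 \<le> y \<Longrightarrow> primitive (\<lambda>t. (b + \<bar>t\<bar>) powr (- a)) y = ((b + y) powr (1 - a) - b powr (1 - a)) / (1 - a)"
proof -
  have I: "((\<lambda>t. (b + \<bar>t\<bar>) powr (- a)) has_integral
      ((b + y) powr (1 - a) / (1 - a) - b powr (1 - a) / (1 - a))) {0..y}" if "0 \<le> y" for y
  proof -
    define F where "F t = (b + t) powr (1 - a) / (1 - a)" for t
    have "((\<lambda>t. (b + \<bar>t\<bar>) powr (- a)) has_integral (F y - F 0)) {0..y}"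
    proof (rule fundamental_theorem_of_calculus_interior[OF that])
      show "continuous_on {0..y} F"
        unfolding F_def using a b by (auto intro!: continuous_intros continuous_on_powr')
      fix t assume "t \<in> {0<..<y}"
      then show "(F has_vector_derivative (b + \<bar>t\<bar>) powr (- a)) (at t)"
        using a b unfolding F_def has_real_derivative_iff_has_vector_derivative[symmetric]
        by (auto intro!: derivative_eq_intros)
    qed
    then show ?thesis by (simp add: F_def)
  qed
  show "primitive (\<lambda>t. (b + \<bar>t\<bar>) powr (- a)) y = ((b + y) powr (1 - a) - b powr (1 - a)) / (1 - a)" if "0 \<le> y"
    unfolding primitive_def using integral_unique[OF I[OF that]] by (simp add: diff_divide_distrib)
  have "(\<lambda>t. (b + \<bar>t\<bar>) powr (- a)) integrable_on {0..y}" for y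
    using I[of y] by (cases "0 \<le> y") auto
  then show "convex_profile (\<lambda>t. (b + \<bar>t\<bar>) powr (- a))"
    using convex_on_abs_powr_neg[OF a(1) b] by (simp add: convex_profile_def)
qed

lemma maximal_function_abs_powr:
  fixes p :: real
  assumes p: "1 < p" and x: "x \<noteq> 0"
  shows "maximal_function (\<lambda>t. \<bar>t\<bar> powr (- 1 / p)) x = ennreal (peak_const p * \<bar>x\<bar> powr (- 1 / p))"
proof -
  obtain \<tau> c where \<tau>: "1 < \<tau>" "\<tau> < p" and c: "0 < c"
    and crit: "(\<tau> + 1) powr (- 1 / p) = c * (1 - \<tau> / p)" "(\<tau> - 1) powr (- 1 / p) = c * (1 + \<tau> / p)"
    using ex_critical[OF p] by blast
  note critical = p \<tau> c crit
  have pc: "peak_const p = c" by (rule peak_const_critical[OF critical])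
  let ?f = "\<lambda>t::real. \<bar>t\<bar> powr (- 1 / p)"
  define q where "q = (p - 1) / p"
  have q: "1 - 1 / p = q" "0 < q" using p by (auto simp: q_def field_simps)
  have prof: "convex_profile ?f" and primitive: "\<And>y. 0 \<le> y \<Longrightarrow> primitive ?f y = y powr q / q"
    using powr_neg_profile[of "1 / p" 0] p q by auto
  have window_mean: "window_mean ?f ?f y (y * (s - 1)) = peak_quotient p s * y powr (- 1 / p)" if "0 < y" "1 \<le> s" for y s
  proof -
    have e: "y * (s - 1) + 2 * y = y * (s + 1)" "y * (s - 1) + y = y * s" by (auto simp: algebra_simps)
    have "y powr q = y powr (- 1 / p) * y"
      using powr_mult_base[of y "- 1 / p"] that p by (simp add: q(1)[symmetric] mult.commute)
    then have "primitive ?f (y * (s + 1)) = y powr (- 1 / p) * y * (s + 1) powr q / q"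
      and "primitive ?f (y * (s - 1)) = y powr (- 1 / p) * y * (s - 1) powr q / q"
      using that primitive[of "y * (s + 1)"] primitive[of "y * (s - 1)"] by (simp_all only: powr_mult) simp_all
    moreover have "(z * y * A / q + z * y * B / q) / (2 * (y * s)) = (A + B) / (2 * s * q) * z" for z A B
      using that q by (simp add: field_simps)
    ultimately show ?thesis unfolding window_mean_def e peak_quotient_def q_def[symmetric] by simp
  qed
  have pos: "maximal_function ?f y = ennreal (c * y powr (- 1 / p))" if y: "0 < y" for y
  proof -
    have "maximal_function ?f y = (SUP v\<in>{0..}. ennreal (window_mean ?f ?f y v))"
      using maximal_function_eq_SUP_window_mean[of ?f y] prof y by simp
    also have "\<dots> = ennreal (c * y powr (- 1 / p))"
    proof (rule antisym)
      show "(SUP v\<in>{0..}. ennreal (window_mean ?f ?f y v)) \<le> ennreal (c * y powr (- 1 / p))"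
      proof (intro SUP_least ennreal_leI)
        fix v :: real assume v: "v \<in> {0..}"
        have "v = y * ((v / y + 1) - 1)" "1 \<le> v / y + 1" using y v by auto
        then show "window_mean ?f ?f y v \<le> c * y powr (- 1 / p)"
          using window_mean[OF y, of "v / y + 1"] peak_quotient_le_critical[OF critical, of "v / y + 1"]
          by (metis mult_right_mono powr_ge_zero)
      qed
      have "ennreal (window_mean ?f ?f y (y * (\<tau> - 1))) \<le> (SUP v\<in>{0..}. ennreal (window_mean ?f ?f y v))"
        using y \<tau> by (intro SUP_upper) auto
      then show "ennreal (c * y powr (- 1 / p)) \<le> (SUP v\<in>{0..}. ennreal (window_mean ?f ?f y v))"
        using window_mean[OF y, of \<tau>] peak_quotient_critical[OF critical] \<tau> by simp
    qed
    finally show ?thesis .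
  qed
  have "?f \<in> borel_measurable lebesgue" by (intro measurable_completion) measurable
  from maximal_function_affine[OF this, of "- 1" 0 "- x"]
  have "maximal_function ?f (- x) = maximal_function ?f x" by simp
  then show ?thesis using pos[of x] pos[of "- x"] x pc by (cases "0 < x") auto
qed

lemma nn_integral_even:
  fixes h :: "real \<Rightarrow> ennreal"
  assumes [measurable]: "h \<in> borel_measurable borel"
  shows "(\<integral>\<^sup>+x. h \<bar>x\<bar> \<partial>lborel) = 2 * (\<integral>\<^sup>+x\<in>{0..}. h x \<partial>lborel)"
proof -
  have "(\<integral>\<^sup>+x. h \<bar>x\<bar> \<partial>lborel) = (\<integral>\<^sup>+x. h x * indicator {0..} x + h (- x) * indicator {..<0} x \<partial>lborel)"
    by (intro nn_integral_cong) (auto simp: indicator_def)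
  also have "\<dots> = (\<integral>\<^sup>+x. h x * indicator {0..} x \<partial>lborel) + (\<integral>\<^sup>+x. h (- x) * indicator {..<0} x \<partial>lborel)"
    by (intro nn_integral_add) measurable
  also have "(\<integral>\<^sup>+x. h (- x) * indicator {..<0} x \<partial>lborel) = (\<integral>\<^sup>+x. h x * indicator {0<..} x \<partial>lborel)"
  proof -
    have "(\<lambda>x. h (- x) * indicator {..<0} x) \<in> borel_measurable borel" by measurable
    from nn_integral_real_affine[OF this, of "- 1" 0] show ?thesis
      by (auto intro!: nn_integral_cong simp: indicator_def)
  qed
  also have "\<dots> = (\<integral>\<^sup>+x. h x * indicator {0..} x \<partial>lborel)"
  proof (rule nn_integral_cong_AE)
    show "AE x in lborel. h x * indicator {0<..} x = h x * indicator {0..} x"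
      using AE_lborel_singleton[of "0::real"] by eventually_elim (auto simp: indicator_def)
  qed
  finally show ?thesis by (simp add: mult_2)
qed

lemma nn_integral_abs_powr:
  fixes s :: real
  assumes s: "0 < s"
  shows "(\<integral>\<^sup>+x. ennreal ((1 + \<bar>x\<bar>) powr (- s - 1)) \<partial>lborel) = ennreal (2 / s)"
proof -
  have "(\<integral>\<^sup>+x. ennreal ((1 + x) powr (- s - 1)) * indicator {0..} x \<partial>lborel) = ennreal (0 - (- ((1 + 0) powr (- s)) / s))"
  proof (rule nn_integral_FTC_atLeast)
    show "((\<lambda>x. - ((1 + x) powr (- s)) / s) has_real_derivative (1 + x) powr (- s - 1)) (at x)" if "0 \<le> x" for x
      using that s by (auto intro!: derivative_eq_intros)
    have "((\<lambda>x. (1 + x) powr (- s)) \<longlongrightarrow> 0) at_top"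
      using s by (intro tendsto_neg_powr filterlim_tendsto_add_at_top[OF tendsto_const] filterlim_ident) auto
    from tendsto_divide[OF tendsto_minus[OF this] tendsto_const[of s]]
    show "((\<lambda>x. - ((1 + x) powr (- s)) / s) \<longlongrightarrow> 0) at_top" using s by simp
  qed auto
  moreover have "2 * ennreal (1 / s) = ennreal (2 / s)"
    using s by (simp add: ennreal_mult'[symmetric] flip: ennreal_numeral)
  ultimately show ?thesis
    using nn_integral_even[of "\<lambda>x. ennreal ((1 + x) powr (- s - 1))"] by simp
qed

section \<open>Sharpness\<close>

text \<open>The half-width of the window is \<tau> times the distance from x to -1, the singularity of
(1 + t)^(-a), so that the mean scales like a power of that distance. The error term comes from the pieces of the two
power functions near their singularities, which are missing.\<close>

lemma maximal_function_shifted_power_ge: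
  fixes a \<tau> x :: real
  assumes a: "0 < a" "a < 1" and \<tau>: "1 < \<tau>" and x: "x \<noteq> 0"
  shows "ennreal (((\<tau> + 1) powr (1 - a) + (\<tau> - 1) powr (1 - a)) / (2 * \<tau> * (1 - a)) * (1 + \<bar>x\<bar>) powr (- a)
      - 1 / (\<tau> * (1 - a)) / (1 + \<bar>x\<bar>)) \<le> maximal_function (\<lambda>t. (1 + \<bar>t\<bar>) powr (- a)) x"
    (is "ennreal (?l \<bar>x\<bar>) \<le> maximal_function ?f x")
proof -
  have pos: "ennreal (?l y) \<le> maximal_function ?f y" if y: "0 < y" for y
  proof -
    define z where "z = 1 + y"
    define v where "v = \<tau> * z - y"
    have z: "0 < z" "y < z" using y by (auto simp: z_def)
    have "1 * z \<le> \<tau> * z" using \<tau> z by (intro mult_right_mono) auto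
    then have v: "0 \<le> v" using z unfolding v_def by linarith
    have u: "1 + (v + 2 * y) = (\<tau> + 1) * z" by (simp add: v_def z_def algebra_simps)
    have w: "(\<tau> - 1) * z \<le> 1 + v" using z by (simp add: v_def z_def algebra_simps)
    have zp: "z powr (1 - a) = z * z powr (- a)" using powr_mult_base[of z "- a"] z by simp
    have "primitive ?f (v + 2 * y) = (z * z powr (- a) * (\<tau> + 1) powr (1 - a) - 1) / (1 - a)"
      using powr_neg_profile(2)[OF a, of 1 "v + 2 * y"] v y \<tau> z unfolding u by (simp add: powr_mult zp mult.commute)
    moreover have "(z * z powr (- a) * (\<tau> - 1) powr (1 - a) - 1) / (1 - a) \<le> primitive ?f v"
    proof -
      have "((\<tau> - 1) * z) powr (1 - a) \<le> (1 + v) powr (1 - a)" using w a \<tau> z by (intro powr_mono2) auto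
      then show ?thesis
        using powr_neg_profile(2)[OF a, of 1 v] v a \<tau> z
        by (simp add: powr_mult zp mult.commute divide_right_mono)
    qed
    ultimately have num: "(z * (z powr (- a) * ((\<tau> + 1) powr (1 - a) + (\<tau> - 1) powr (1 - a))) - 2) / (1 - a)
        \<le> primitive ?f (v + 2 * y) + primitive ?f v"
      by (simp add: algebra_simps diff_divide_distrib add_divide_distrib)
    have "?l y = (z * (z powr (- a) * ((\<tau> + 1) powr (1 - a) + (\<tau> - 1) powr (1 - a))) - 2) / (1 - a) / (2 * (\<tau> * z))"
    proof -
      have "A / (2 * \<tau> * e) * Y - 1 / (\<tau> * e) / z = (z * (Y * A) - 2) / e / (2 * (\<tau> * z))" if "e \<noteq> 0" for A Y e
        using z \<tau> that by (simp add: field_simps)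
      from this[of "1 - a"] show ?thesis unfolding z_def[symmetric] using a y by (simp add: z_def)
    qed
    also have "\<dots> \<le> (primitive ?f (v + 2 * y) + primitive ?f v) / (2 * (\<tau> * z))"
      using num z \<tau> by (intro divide_right_mono) auto
    also have "\<dots> = window_mean ?f ?f y v" by (simp add: window_mean_def v_def)
    finally have "ennreal (?l y) \<le> ennreal (window_mean ?f ?f y v)" by (rule ennreal_leI)
    also have "\<dots> \<le> (SUP v\<in>{0..}. ennreal (window_mean ?f ?f y v))" using v by (intro SUP_upper) auto
    also have "\<dots> = maximal_function ?f y"
      using maximal_function_eq_SUP_window_mean[of ?f y] powr_neg_profile(1)[OF a, of 1] y by simp
    finally show ?thesis .
  qed
  have "?f \<in> borel_measurable lebesgue" by (intro measurable_completion) measurable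
  from maximal_function_affine[OF this, of "- 1" 0 "- x"]
  have "maximal_function ?f (- x) = maximal_function ?f x" by simp
  then show ?thesis using pos[of "\<bar>x\<bar>"] x by (cases "0 < x") auto
qed

lemma shifted_power_peak_shaped:
  assumes p: "1 < p" and a: "1 / p < a" "a < 1"
  shows "(\<lambda>t. (1 + \<bar>t\<bar>) powr (- a)) \<in> peak_shaped \<inter> Lp_space p"
    and "(\<integral>\<^sup>+x. ennpow (ennreal \<bar>(1 + \<bar>x\<bar>) powr (- a)\<bar>) p \<partial>lebesgue) = ennreal (2 / (a * p - 1))"
proof -
  let ?f = "\<lambda>t::real. (1 + \<bar>t\<bar>) powr (- a)"
  have a0: "0 < a" using p a by (meson less_trans zero_less_divide_1_iff zero_less_one)
  have s: "0 < a * p - 1" using a p by (simp add: field_simps)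
  show I: "(\<integral>\<^sup>+x. ennpow (ennreal \<bar>?f x\<bar>) p \<partial>lebesgue) = ennreal (2 / (a * p - 1))"
    using nn_integral_abs_powr[OF s] by (simp add: nn_integral_completion powr_powr)
  have "?f \<in> borel_measurable lebesgue" by (intro measurable_completion) measurable
  moreover have "Lp_norm p (\<lambda>x. ennreal \<bar>?f x\<bar>) < \<infinity>"
    unfolding Lp_norm_def I using s by simp
  ultimately show "?f \<in> peak_shaped \<inter> Lp_space p"
    using convex_on_abs_powr_neg[OF a0, of 1] unfolding peak_shaped_def Lp_space_def by auto
qed

text \<open>The main term of the lower bound for M f is Q f, and its p-th power has integral 2 Q^p / (a p - 1), the same
singular factor as the integral of f^p. By the tangent inequality the error changes the p-th power by at most
p Q^(p-1) k (1 + |x|)^(-s2 - 1), whose integral stays bounded as a decreases to 1/p. Multiplying by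
a p - 1 removes the singularity.\<close>

lemma sharpness_inequality:
  fixes p a \<tau> C :: real
  assumes p: "1 < p" and a: "1 / p < a" "a < 1" and \<tau>: "1 < \<tau>" and C: "0 \<le> C"
    and le: "\<And>f. f \<in> peak_shaped \<inter> Lp_space p \<Longrightarrow>
      Lp_norm p (maximal_function f) \<le> ennreal C * Lp_norm p (\<lambda>x. ennreal \<bar>f x\<bar>)"
    and Q: "Q = ((\<tau> + 1) powr (1 - a) + (\<tau> - 1) powr (1 - a)) / (2 * \<tau> * (1 - a))"
    and k: "k = 1 / (\<tau> * (1 - a))"
  shows "Q powr p - (a * p - 1) * (p * Q powr (p - 1) * k) / (a * (p - 1)) \<le> C powr p"
proof -
  let ?f = "\<lambda>t::real. (1 + \<bar>t\<bar>) powr (- a)"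
  have a0: "0 < a" using p a by (meson less_trans zero_less_divide_1_iff zero_less_one)
  define s1 where "s1 = a * p - 1"
  define s2 where "s2 = a * (p - 1)"
  have s: "0 < s1" "0 < s2" using a a0 p by (auto simp: s1_def s2_def field_simps)
  have Q0: "0 < Q" and k0: "0 < k" using \<tau> a by (auto simp: Q k intro!: divide_pos_pos add_pos_pos)
  define m where "m x = max 0 (Q * (1 + \<bar>x\<bar>) powr (- a) - k / (1 + \<bar>x\<bar>))" for x
  define M where "M = (\<integral>\<^sup>+x. ennpow (maximal_function ?f x) p \<partial>lebesgue)"
  define B where "B = p * Q powr (p - 1) * k"
  have B0: "0 \<le> B" using p k0 by (simp add: B_def)
  have mm[measurable]: "m \<in> borel_measurable borel" unfolding m_def by measurable
  have "(\<integral>\<^sup>+x. ennreal (m x powr p) \<partial>lborel) \<le> M"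
    unfolding M_def nn_integral_completion
  proof (rule nn_integral_mono_AE)
    show "AE x in lborel. ennreal (m x powr p) \<le> ennpow (maximal_function ?f x) p"
      using AE_lborel_singleton[of "0::real"]
    proof eventually_elim
      case (elim x)
      have "ennreal (m x) \<le> maximal_function ?f x"
        using maximal_function_shifted_power_ge[OF a0 a(2) \<tau>, of x] elim
        unfolding m_def Q k by (simp add: max_def ennreal_neg)
      then have "ennpow (ennreal (m x)) p \<le> ennpow (maximal_function ?f x) p"
        using p by (intro ennpow_mono) auto
      then show ?case by (simp add: m_def)
    qed
  qed
  moreover have "(\<integral>\<^sup>+x. ennreal (Q powr p * (1 + \<bar>x\<bar>) powr (- s1 - 1)) \<partial>lborel)
      \<le> (\<integral>\<^sup>+x. ennreal (m x powr p) + ennreal (B * (1 + \<bar>x\<bar>) powr (- s2 - 1)) \<partial>lborel)"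
  proof (rule nn_integral_mono)
    fix x :: real
    define z where "z = 1 + \<bar>x\<bar>"
    define r where "r = Q * z powr (- a)"
    have z: "0 < z" by (simp add: z_def)
    have r: "0 < r" using Q0 z by (simp add: r_def)
    have "p * r powr (p - 1) * (r - k / z) \<le> p * r powr (p - 1) * m x"
      using p by (intro mult_left_mono) (auto simp: m_def r_def z_def)
    also have "\<dots> \<le> m x powr p + (p - 1) * r powr p"
      using p r by (intro powr_tangent) (auto simp: m_def)
    finally have "p * (r powr (p - 1) * r) - p * r powr (p - 1) * (k / z) \<le> m x powr p + (p - 1) * r powr p"
      by (simp add: algebra_simps)
    moreover have "r powr (p - 1) * r = r powr p" using powr_mult_base[of r "p - 1"] r by (simp add: mult.commute)
    ultimately have "r powr p \<le> m x powr p + p * r powr (p - 1) * (k / z)"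
      by (simp add: algebra_simps)
    moreover have "r powr p = Q powr p * z powr (- s1 - 1)"
      using Q0 z by (simp add: r_def s1_def powr_mult powr_powr)
    moreover have "p * r powr (p - 1) * (k / z) = B * z powr (- s2 - 1)"
    proof -
      have "r powr (p - 1) = Q powr (p - 1) * z powr (- s2)"
        using Q0 z by (simp add: r_def s2_def powr_mult powr_powr)
      moreover have "z powr (- s2 - 1) = z powr (- s2) / z" using z by (simp add: powr_diff)
      ultimately show ?thesis by (simp add: B_def)
    qed
    ultimately have "Q powr p * z powr (- s1 - 1) \<le> m x powr p + B * z powr (- s2 - 1)" by simp
    then show "ennreal (Q powr p * (1 + \<bar>x\<bar>) powr (- s1 - 1))
        \<le> ennreal (m x powr p) + ennreal (B * (1 + \<bar>x\<bar>) powr (- s2 - 1))"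
      using B0 by (simp add: z_def ennreal_leI ennreal_plus[symmetric] del: ennreal_plus)
  qed
  moreover have "(\<integral>\<^sup>+x. ennreal (Q powr p * (1 + \<bar>x\<bar>) powr (- s1 - 1)) \<partial>lborel) = ennreal (Q powr p * (2 / s1))"
  proof -
    have "ennreal (Q powr p * (2 / s1)) = ennreal (Q powr p) * ennreal (2 / s1)"
      using s by (intro ennreal_mult) auto
    then show ?thesis using s by (simp add: ennreal_mult nn_integral_cmult nn_integral_abs_powr)
  qed
  moreover have "(\<integral>\<^sup>+x. ennreal (m x powr p) + ennreal (B * (1 + \<bar>x\<bar>) powr (- s2 - 1)) \<partial>lborel)
      = (\<integral>\<^sup>+x. ennreal (m x powr p) \<partial>lborel) + ennreal (B * (2 / s2))"
  proof -
    have "ennreal (B * (2 / s2)) = ennreal B * ennreal (2 / s2)"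
      using s B0 by (intro ennreal_mult) auto
    then show ?thesis
      using s B0 by (simp add: nn_integral_add ennreal_mult nn_integral_cmult nn_integral_abs_powr)
  qed
  moreover have "M \<le> ennreal (C powr p * (2 / s1))"
  proof -
    have "ennpow (ennpow M (1 / p)) p \<le> ennpow (ennreal C * ennpow (ennreal (2 / s1)) (1 / p)) p"
      using le[OF shifted_power_peak_shaped(1)[OF p a]] p
      unfolding Lp_norm_def shifted_power_peak_shaped(2)[OF p a] M_def s1_def
      by (intro ennpow_mono) auto
    also have "\<dots> = ennreal (C powr p) * ennreal (2 / s1)"
      using C p by (simp only: ennpow_mult ennpow_ennpow')
    also have "\<dots> = ennreal (C powr p * (2 / s1))" using s by (intro ennreal_mult[symmetric]) auto
    finally show ?thesis using p by (simp add: ennpow_ennpow')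
  qed
  ultimately have "ennreal (Q powr p * (2 / s1)) \<le> ennreal (C powr p * (2 / s1)) + ennreal (B * (2 / s2))"
    by (smt (verit) add_right_mono order_trans)
  also have "\<dots> = ennreal (C powr p * (2 / s1) + B * (2 / s2))"
    using s B0 by (intro ennreal_plus[symmetric]) auto
  finally have "Q powr p * (2 / s1) \<le> C powr p * (2 / s1) + B * (2 / s2)"
    using s B0 by (subst (asm) ennreal_le_iff) auto
  then have "(s1 / 2) * (Q powr p * (2 / s1)) \<le> (s1 / 2) * (C powr p * (2 / s1) + B * (2 / s2))"
    using s by (intro mult_left_mono) auto
  then show ?thesis using s unfolding s1_def[symmetric] s2_def[symmetric] B_def[symmetric]
    by (simp add: distrib_left)
qed

text \<open>Let a decrease to 1/p in the sharpness inequality: for the critical ratio \<tau>, Q tends to peak_quotient p \<tau> = c, and the error term vanishes.\<close>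

lemma peak_const_le:
  assumes p: "1 < p"
    and le: "\<And>f. f \<in> peak_shaped \<inter> Lp_space p \<Longrightarrow>
      Lp_norm p (maximal_function f) \<le> ennreal C * Lp_norm p (\<lambda>x. ennreal \<bar>f x\<bar>)"
  shows "peak_const p \<le> C"
proof -
  obtain \<tau> c where \<tau>: "1 < \<tau>" "\<tau> < p" and c: "0 < c"
    and crit: "(\<tau> + 1) powr (- 1 / p) = c * (1 - \<tau> / p)" "(\<tau> - 1) powr (- 1 / p) = c * (1 + \<tau> / p)"
    using ex_critical[OF p] by blast
  note critical = p \<tau> c crit
  \<comment> \<open>Negative C are mapped to 0 by the embedding into the extended nonnegative reals.\<close>
  define C' where "C' = max 0 C"
  have C': "ennreal C' = ennreal C" "0 \<le> C'" by (auto simp: C'_def max_def ennreal_neg)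
  define Q where "Q a = ((\<tau> + 1) powr (1 - a) + (\<tau> - 1) powr (1 - a)) / (2 * \<tau> * (1 - a))" for a
  define k where "k a = 1 / (\<tau> * (1 - a))" for a
  define G where "G a = Q a powr p - (a * p - 1) * (p * Q a powr (p - 1) * k a) / (a * (p - 1))" for a
  have p1: "1 / p < 1" "0 < 1 / p" using p by auto
  have Qc: "Q (1 / p) = c"
    using peak_quotient_critical[OF critical] p by (simp add: Q_def peak_quotient_def diff_divide_distrib)
  have "isCont Q (1 / p)" "isCont k (1 / p)"
    unfolding Q_def k_def using \<tau> p1 by (auto intro!: continuous_intros)
  then have "isCont G (1 / p)"
    unfolding G_def using p p1 c Qc by (auto intro!: continuous_intros)
  then have "(G \<longlongrightarrow> G (1 / p)) (at_right (1 / p))"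
    by (simp add: isCont_def filterlim_at_split)
  moreover have "\<forall>\<^sub>F a in at_right (1 / p). G a \<le> C' powr p"
    unfolding eventually_at_right_field
  proof (intro exI[of _ 1] conjI allI impI)
    fix a assume "1 / p < a" "a < 1"
    then show "G a \<le> C' powr p"
      unfolding G_def using sharpness_inequality[OF p _ _ \<tau>(1) C'(2) _ Q_def k_def, of a] le C'(1) by simp
  qed (use p1 in auto)
  ultimately have "G (1 / p) \<le> C' powr p" by (rule tendsto_upperbound) simp
  then have "c powr p \<le> C' powr p" using p by (simp add: G_def Qc)
  then have "c \<le> C'" using c C' p by (metis less_eq_real_def less_le_trans not_le powr_less_mono2 zero_less_one)
  then show ?thesis using c peak_const_critical[OF critical] by (simp add: C'_def max_def split: if_splits)
qed

theorem mainTheorem1: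
  fixes p :: real
  assumes "1 < p"
  shows "(\<forall>f \<in> peak_shaped \<inter> Lp_space p.
            Lp_norm p (maximal_function f) \<le> ennreal (peak_const p) * Lp_norm p (\<lambda>x. ennreal \<bar>f x\<bar>))
       \<and> (\<forall>C::real. (\<forall>f \<in> peak_shaped \<inter> Lp_space p.
              Lp_norm p (maximal_function f) \<le> ennreal C * Lp_norm p (\<lambda>x. ennreal \<bar>f x\<bar>))
            \<longrightarrow> peak_const p \<le> C)
       \<and> (\<forall>c::real. (\<forall>x. x \<noteq> 0 \<longrightarrow>
              maximal_function (\<lambda>t. \<bar>t\<bar> powr (- 1 / p)) x = ennreal (c * \<bar>x\<bar> powr (- 1 / p)))
            \<longleftrightarrow> c = peak_const p)"
proof (intro conjI allI ballI impI iffI)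
  fix f assume "f \<in> peak_shaped \<inter> Lp_space p"
  then show "Lp_norm p (maximal_function f) \<le> ennreal (peak_const p) * Lp_norm p (\<lambda>x. ennreal \<bar>f x\<bar>)"
    by (rule Lp_norm_maximal_function_le[OF assms])
next
  fix C :: real
  assume "\<forall>f \<in> peak_shaped \<inter> Lp_space p.
    Lp_norm p (maximal_function f) \<le> ennreal C * Lp_norm p (\<lambda>x. ennreal \<bar>f x\<bar>)"
  then show "peak_const p \<le> C" by (intro peak_const_le[OF assms]) blast
next
  fix c :: real
  assume "\<forall>x. x \<noteq> 0 \<longrightarrow>
    maximal_function (\<lambda>t. \<bar>t\<bar> powr (- 1 / p)) x = ennreal (c * \<bar>x\<bar> powr (- 1 / p))"
  then have "ennreal c = ennreal (peak_const p)"
    using maximal_function_abs_powr[OF assms, of 1] by (metis abs_one mult.right_neutral powr_one_eq_one zero_neq_one)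
  moreover have "0 < peak_const p" by (metis ex_critical[OF assms] peak_const_critical[OF assms])
  ultimately show "c = peak_const p" by (metis ennreal_eq_0_iff ennreal_inj linear not_le)
next
  fix c x :: real assume "c = peak_const p" "x \<noteq> 0"
  then show "maximal_function (\<lambda>t. \<bar>t\<bar> powr (- 1 / p)) x = ennreal (c * \<bar>x\<bar> powr (- 1 / p))"
    using maximal_function_abs_powr[OF assms] by simp
qed

end
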